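(* For the Poisson operator $-\Delta$ on $(0,1)^d$, the local-channel factorization $\mathrm J_s=\Psi_s^{\mathrm{ch}}\mathsf C_s^{\mathrm{ch}}$ of the collocated Jacobian blocks holds with $$\Psi_s^{\mathrm{ch}}=[\Psi_{s,0}^{\mathrm{ch}}\ \ \Psi_{s,2}^{\mathrm{ch}}],\qquad \mathsf C_s^{\mathrm{ch}}=\begin{bmatrix}\mathsf H_{s,0}\\ \mathsf H_{s,2}\end{bmatrix},\qquad N_s^{\mathrm{ch}}=2n_sk_s,$$ where $\Psi_{s,\ell}^{\mathrm{ch}}$ are the local-channel direction matrices and $\mathsf H_{s,\ell}$ the sensitivity matrices defined in the context, and the direction matrices have the following explicit form. (i) CP format ($k_s=R$, $\Psi_{s,\ell}^{\mathrm{ch}}\in\mathbb R^{N_{\mathcal D}\times n_sR}$): $$\Psi_{s,0}^{\mathrm{ch}}(i,\overline{j_s\alpha})=-\delta_{i_sj_s}\sum_{\beta\ne s}(u_\beta^\alpha)''(z_{\beta,i_\beta})\prod_{m\ne s,\beta}u_m^\alpha(z_{m,i_m}),\qquad \Psi_{s,2}^{\mathrm{ch}}(i,\overline{j_s\alpha})=-\delta_{i_sj_s}\prod_{m\ne s}u_m^\alpha(z_{m,i_m}).$$ (ii) TT format ($k_s=r_{s-1}r_s$, $a_s=\overline{\alpha_{s-1}\alpha_s}$, $\mathsf M_{a_s}=\mathrm e_{\alpha_{s-1}}\mathrm e_{\alpha_s}^\top\in\mathbb R^{r_{s-1}\times r_s}$, $\Psi_{s,\ell}^{\mathrm{ch}}\in\mathbb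 R^{N_{\mathcal D}\times n_sk_s}$): with $$\mathcal B_m^\Delta:=\begin{bmatrix}G_m&-G_m''\\0&G_m\end{bmatrix},\quad \mathsf P_{s,0,a_s}^\Delta:=\begin{bmatrix}\mathsf M_{a_s}&0\\0&\mathsf M_{a_s}\end{bmatrix},\quad \mathsf P_{s,2,a_s}^\Delta:=\begin{bmatrix}0&-\mathsf M_{a_s}\\0&0\end{bmatrix},$$ $$\mathcal Q_{<s}^\Delta:=\begin{bmatrix}1&0\end{bmatrix}\prod_{m<s}\mathcal B_m^\Delta\in\mathbb R^{1\times2r_{s-1}},\qquad \mathcal Q_{>s}^\Delta:=\Big(\prod_{m>s}\mathcal B_m^\Delta\Big)\begin{bmatrix}0\\1\end{bmatrix}\in\mathbb R^{2r_s\times1}$$ (products in increasing order of $m$; functions of $z_{<s}=(z_1,\dots,z_{s-1})$ and $z_{>s}=(z_{s+1},\dots,z_d)$ respectively), for $\ell\in\{0,2\}$, $$\Psi_{s,\ell}^{\mathrm{ch}}(i,\overline{j_sa_s})=\delta_{i_sj_s}\,\mathcal Q_{<s}^\Delta(z_{<s,i_{<s}})\,\mathsf P_{s,\ell,a_s}^\Delta\,\mathcal Q_{>s}^\Delta(z_{>s,i_{>s}}).$$ Consequently, the effective compressed dimensions $N_{\mathrm{eff}}^{\mathrm{ch}}=\sum_sN_s^{\mathrm{ch}}$ are $N_{\mathrm{eff}}^{\mathrm{ch,CP}}=2R\sum_{s=1}^dn_s$ and $N_{\mathrm{eff}}^{\mathrm{ch,TT}}=2\sum_{s=1}^dn_s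r_{s-1}r_s$.
   Context: $\mathcal D=\Omega=(0,1)^d$, $\mathcal D_m=(0,1)$. The operator is $\mathcal A=-\Delta=\sum_{\beta=1}^d\mathcal A_1^{(\beta)}\otimes\cdots\otimes\mathcal A_d^{(\beta)}$ with $\mathcal A_\beta^{(\beta)}=-\partial_{z_\beta}^2$ and $\mathcal A_m^{(\beta)}=I$ for $m\ne\beta$, acting on $\bigotimes_mH^2(0,1)$. Its local channels are $\Lambda_s=\{0,2\}$, $\mathcal D_{s,0}=I$, $\mathcal D_{s,2}=\partial_{z_s}^2$, $b_{s,0}^{(\beta)}=1-\delta_{s\beta}$, $b_{s,2}^{(\beta)}=-\delta_{s\beta}$, i.e. $\mathcal A_s^{(\beta)}=\sum_{\ell\in\Lambda_s}b_{s,\ell}^{(\beta)}\mathcal D_{s,\ell}$. Ansatz: either CP, $u_\theta(z)=\sum_{\alpha=1}^R\prod_{m=1}^du_m^\alpha(z_m;\theta^m)$, or TT, $u_\theta(z)=G_1(z_1;\theta^1)\cdots G_d(z_d;\theta^d)$ with $G_m$ valued in $\mathbb R^{r_{m-1}\times r_m}$, $r_0=r_d=1$; $\theta^m\in\mathbb R^{P_m}$. The factors/core entries depend differentiably on $\theta^m$ as elements of $H^2(0,1)$, and they and their $\theta^m$-derivatives are twice continuously differentiable in $z_m$ on $[0,1]$, so all point values below are defined. Index convention: $\overline{i_1\ldots i_k}$ is the lexicographic position (leftmost index slowest). Factor grids $\{z_{m,1},\dots,z_{m,n_m}\}\subset(0,1)$, $N_{\mathcal D}=\prod_mn_m$, $z_i=(z_{1,i_1},\dots,z_{d,i_d})$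 for $i=\overline{i_1\ldots i_d}$; $i_{-s}$ is the multi-index without $i_s$. $\mathrm J_s\in\mathbb R^{N_{\mathcal D}\times P_s}$, $\mathrm J_s(i,p)=(-\Delta\,\partial_{\theta^s_p}u_\theta)(z_i)$. Sensitivity matrices $\mathsf H_{s,\ell}\in\mathbb R^{n_sk_s\times P_s}$: $\mathsf H_{s,\ell}(\overline{i_sa_s},p)=(\partial_{z_s}^\ell\partial_{\theta^s_p}u_s^{a_s})(z_{s,i_s})$ for CP ($k_s=R$, $a_s=\alpha$) and $\mathsf H_{s,\ell}(\overline{i_sa_s},p)=(\partial_{z_s}^\ell\partial_{\theta^s_p}G_s)(z_{s,i_s})(\alpha_{s-1},\alpha_s)$ for TT ($k_s=r_{s-1}r_s$, $a_s=\overline{\alpha_{s-1}\alpha_s}$). Local-channel direction matrices: $\Psi_{s,\ell}^{\mathrm{ch}}(i,\overline{j_sa_s})=\delta_{i_sj_s}\sum_{\beta=1}^db_{s,\ell}^{(\beta)}(z_{s,j_s})\,\mathsf E_s^{(\beta)}(\overline{i_{-s}},a_s)$, where $\mathsf E_s^{(\beta)}(\overline{i_{-s}},\alpha)=\prod_{m\ne s}(\mathcal A_m^{(\beta)}u_m^\alpha)(z_{m,i_m})$ for CP and $\mathsf E_s^{(\beta)}(\overline{i_{-s}},\overline{\alpha_{s-1}\alpha_s})=\big[\prod_{m<s}(\mathcal A_m^{(\beta)}G_m)(z_{m,i_m})\big](1,\alpha_{s-1})\,\big[\prod_{m>s}(\mathcal A_m^{(\beta)}G_m)(z_{m,i_m})\big](\alpha_s,1)$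 for TT (ordered matrix products, operators applied entrywise, empty products equal $1$). *)

theory Defs
  imports "HOL-Analysis.Analysis" "Jordan_Normal_Form.Matrix"
begin

(* Vectors and matrices are those of Jordan_Normal_Form. *)
unbundle no vec_syntax
hide_const (open) Finite_Cartesian_Product.vec Finite_Cartesian_Product.mat
  Finite_Cartesian_Product.row
hide_type (open) Finite_Cartesian_Product.vec
notation Matrix.vec_index (infixl "$" 100)

(* Everything is indexed from 0: modes are 0, ..., d - 1; core m of a tensor train is of size
   r m x r (m + 1), so that "the rank before mode s" is r s and "the rank after mode s" is
   r (Suc s). *)

section \<open>Index conventions\<close>

(* Lexicographic position of (j 0, ..., j (d-1)) among the multi-indices with j m < n m,
   leftmost index slowest; mi_digit is its inverse. *)
definition mi_stride :: "nat \<Rightarrow> (nat \<Rightarrow> nat) \<Rightarrow> nat \<Rightarrow> nat" where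
  "mi_stride d n m = (\<Prod>k\<in>{m<..<d}. n k)"

definition mi_pos :: "nat \<Rightarrow> (nat \<Rightarrow> nat) \<Rightarrow> (nat \<Rightarrow> nat) \<Rightarrow> nat" where
  "mi_pos d n j = (\<Sum>m<d. j m * mi_stride d n m)"

definition mi_digit :: "nat \<Rightarrow> (nat \<Rightarrow> nat) \<Rightarrow> nat \<Rightarrow> nat \<Rightarrow> nat" where
  "mi_digit d n i m = (i div mi_stride d n m) mod n m"

(* Lexicographic position of (i, a) when a ranges over {..<k}; the inverse is given by
   div k and mod k. *)
definition pair_pos :: "nat \<Rightarrow> nat \<Rightarrow> nat \<Rightarrow> nat" where
  "pair_pos k i a = i * k + a"

lemma mi_stride_Suc:
  assumes "m < d"
  shows "mi_stride (Suc d) n m = n d * mi_stride d n m"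
proof -
  have "{m<..<Suc d} = insert d {m<..<d}" using assms by auto
  then show ?thesis by (simp add: mi_stride_def)
qed

lemma mi_stride_last: "mi_stride (Suc d) n d = 1"
proof -
  have "{d<..<Suc d} = {}" by auto
  then show ?thesis by (simp add: mi_stride_def)
qed

lemma mi_pos_Suc: "mi_pos (Suc d) n j = n d * mi_pos d n j + j d"
  by (simp add: mi_pos_def mi_stride_last mi_stride_Suc sum_distrib_left algebra_simps)

lemma mi_pos_less:
  assumes "\<And>m. m < d \<Longrightarrow> j m < n m"
  shows "mi_pos d n j < (\<Prod>m<d. n m)"
  using assms
proof (induction d)
  case 0
  then show ?case by (simp add: mi_pos_def)
next
  case (Suc d)
  have "mi_pos d n j < (\<Prod>m<d. n m)" using Suc by simp
  then have "n d * Suc (mi_pos d n j) \<le> n d * (\<Prod>m<d. n m)"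
    by (intro mult_le_mono2) simp
  moreover have "j d < n d" using Suc.prems by simp
  ultimately show ?case by (simp add: mi_pos_Suc algebra_simps)
qed

lemma mi_digit_pos:
  assumes "\<And>m. m < d \<Longrightarrow> j m < n m" "m < d"
  shows "mi_digit d n (mi_pos d n j) m = j m"
  using assms
proof (induction d)
  case 0
  then show ?case by simp
next
  case (Suc d)
  have lt: "j d < n d" using Suc.prems by simp
  show ?case
  proof (cases "m = d")
    case True
    then show ?thesis using lt by (simp add: mi_digit_def mi_stride_last mi_pos_Suc)
  next
    case False
    then have m: "m < d" using Suc.prems by simp
    have "mi_pos (Suc d) n j div n d = mi_pos d n j"
      using lt by (simp add: mi_pos_Suc)
    then have "mi_digit (Suc d) n (mi_pos (Suc d) n j) m = mi_digit d n (mi_pos d n j) m"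
      by (simp add: mi_digit_def mi_stride_Suc[OF m] div_mult2_eq)
    then show ?thesis using Suc.IH Suc.prems m by simp
  qed
qed

section \<open>Derivatives and the Poisson operator\<close>

definition partial :: "nat \<Rightarrow> (real vec \<Rightarrow> real) \<Rightarrow> real vec \<Rightarrow> real" where
  "partial p f x = deriv (\<lambda>t. f (x + t \<cdot>\<^sub>v unit_vec (dim_vec x) p)) 0"

definition neg_laplacian :: "(real vec \<Rightarrow> real) \<Rightarrow> real vec \<Rightarrow> real" where
  "neg_laplacian f z = - (\<Sum>\<beta><dim_vec z. partial \<beta> (partial \<beta> f) z)"

(* The mode-m factor of the beta-th summand of the separable form of the negative Laplacian. *)
definition mode_op :: "nat \<Rightarrow> nat \<Rightarrow> (real \<Rightarrow> real) \<Rightarrow> real \<Rightarrow> real" where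
  "mode_op \<beta> m f = (if m = \<beta> then (\<lambda>x. - (deriv ^^ 2) f x) else f)"

(* Local channels: the channel set of every mode is {0, 2}, the channel operators are
   deriv ^^ l, and the coefficients are constant functions. *)
definition chan_coeff :: "nat \<Rightarrow> nat \<Rightarrow> nat \<Rightarrow> real" where
  "chan_coeff s l \<beta> =
     (if l = 0 then 1 - of_bool (s = \<beta>) else if l = 2 then - of_bool (s = \<beta>) else 0)"

lemma mode_op_channels:
  "mode_op \<beta> s f x = (\<Sum>l\<in>{0,2}. chan_coeff s l \<beta> * (deriv ^^ l) f x)"
  by (simp add: mode_op_def chan_coeff_def)

section \<open>Regularity of the factors\<close>

definition C2_unit :: "(real \<Rightarrow> real) \<Rightarrow> bool" where
  "C2_unit f \<longleftrightarrow> (\<exists>f' f''. continuous_on {0..1} f'' \<and>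
     (\<forall>x\<in>{0..1}. (f has_real_derivative f' x) (at x within {0..1}) \<and>
                 (f' has_real_derivative f'' x) (at x within {0..1})))"

(* The norm of the Sobolev space on (0,1). It is only applied to functions that are C2 on [0,1],
   whose weak derivatives are the classical ones. *)
definition H2_norm :: "(real \<Rightarrow> real) \<Rightarrow> real" where
  "H2_norm f = sqrt (LINT x:{0<..<1}|lborel.
     (f x)\<^sup>2 + (deriv f x)\<^sup>2 + ((deriv ^^ 2) f x)\<^sup>2)"

(* f maps a parameter vector of dimension P to a function of one variable. The functions w p are
   the parameter derivatives: Frechet differentiability at th with respect to H2_norm. *)
definition H2_differentiable :: "nat \<Rightarrow> (real vec \<Rightarrow> real \<Rightarrow> real) \<Rightarrow> real vec \<Rightarrow> bool" where
  "H2_differentiable P f th \<longleftrightarrow> (\<exists>w. (\<forall>p<P. C2_unit (w p)) \<and>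
     (\<forall>\<epsilon>>0. \<exists>\<delta>>0. \<forall>h\<in>carrier_vec P. sqrt (scalar_prod h h) < \<delta> \<longrightarrow>
        H2_norm (\<lambda>x. f (th + h) x - f th x - (\<Sum>p<P. h $ p * w p x))
          \<le> \<epsilon> * sqrt (scalar_prod h h)))"

definition admissible_factor :: "nat \<Rightarrow> (real vec \<Rightarrow> real \<Rightarrow> real) \<Rightarrow> bool" where
  "admissible_factor P f \<longleftrightarrow>
     (\<forall>th\<in>carrier_vec P. C2_unit (f th) \<and> H2_differentiable P f th)"

section \<open>Ansatz\<close>

definition cp_ansatz ::
  "nat \<Rightarrow> nat \<Rightarrow> (nat \<Rightarrow> nat) \<Rightarrow> (nat \<Rightarrow> nat \<Rightarrow> real vec \<Rightarrow> real \<Rightarrow> real) \<Rightarrow> bool" where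
  "cp_ansatz d R P u \<longleftrightarrow> (\<forall>m<d. \<forall>\<alpha><R. admissible_factor (P m) (u m \<alpha>))"

definition cp_eval ::
  "nat \<Rightarrow> nat \<Rightarrow> (nat \<Rightarrow> nat \<Rightarrow> real vec \<Rightarrow> real \<Rightarrow> real) \<Rightarrow> (nat \<Rightarrow> real vec) \<Rightarrow> real vec \<Rightarrow> real" where
  "cp_eval d R u \<theta> z = (\<Sum>\<alpha><R. \<Prod>m<d. u m \<alpha> (\<theta> m) (z $ m))"

(* The ordered product F a * F (a+1) * ... * F (b-1), where q is the number of columns of the
   result (the empty product is the identity matrix of size q). *)
definition mat_prod :: "nat \<Rightarrow> (nat \<Rightarrow> real mat) \<Rightarrow> nat \<Rightarrow> nat \<Rightarrow> real mat" where
  "mat_prod q F a b = foldr (\<lambda>m X. F m * X) [a..<b] (1\<^sub>m q)"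

definition entrywise ::
  "((real \<Rightarrow> real) \<Rightarrow> real \<Rightarrow> real) \<Rightarrow> (real \<Rightarrow> real mat) \<Rightarrow> real \<Rightarrow> real mat" where
  "entrywise L F x =
     mat (dim_row (F x)) (dim_col (F x)) (\<lambda>(a, b). L (\<lambda>y. F y $$ (a, b)) x)"

definition tt_ansatz ::
  "nat \<Rightarrow> (nat \<Rightarrow> nat) \<Rightarrow> (nat \<Rightarrow> nat) \<Rightarrow> (nat \<Rightarrow> real vec \<Rightarrow> real \<Rightarrow> real mat) \<Rightarrow> bool" where
  "tt_ansatz d r P G \<longleftrightarrow> r 0 = 1 \<and> r d = 1 \<and>
     (\<forall>m<d. (\<forall>th\<in>carrier_vec (P m). \<forall>x\<in>{0..1}. G m th x \<in> carrier_mat (r m) (r (Suc m))) \<and>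
       (\<forall>a<r m. \<forall>b<r (Suc m). admissible_factor (P m) (\<lambda>th x. G m th x $$ (a, b))))"

definition tt_eval ::
  "nat \<Rightarrow> (nat \<Rightarrow> real vec \<Rightarrow> real \<Rightarrow> real mat) \<Rightarrow> (nat \<Rightarrow> real vec) \<Rightarrow> real vec \<Rightarrow> real" where
  "tt_eval d G \<theta> z = mat_prod 1 (\<lambda>m. G m (\<theta> m) (z $ m)) 0 d $$ (0, 0)"

section \<open>Jacobian blocks, sensitivity matrices and direction matrices\<close>

(* n m is the number of grid points of mode m, x m j is the j-th of them. *)

definition grid_point ::
  "nat \<Rightarrow> (nat \<Rightarrow> nat \<Rightarrow> real) \<Rightarrow> (nat \<Rightarrow> nat) \<Rightarrow> real vec" where
  "grid_point d x j = vec d (\<lambda>m. x m (j m))"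

definition jacobian_block ::
  "nat \<Rightarrow> (nat \<Rightarrow> nat) \<Rightarrow> (nat \<Rightarrow> nat \<Rightarrow> real) \<Rightarrow> (nat \<Rightarrow> nat) \<Rightarrow>
   ((nat \<Rightarrow> real vec) \<Rightarrow> real vec \<Rightarrow> real) \<Rightarrow> (nat \<Rightarrow> real vec) \<Rightarrow> nat \<Rightarrow> real mat" where
  "jacobian_block d n x P U \<theta> s = mat (\<Prod>m<d. n m) (P s) (\<lambda>(i, p).
     neg_laplacian (\<lambda>z. partial p (\<lambda>th. U (\<theta>(s := th)) z) (\<theta> s))
       (grid_point d x (mi_digit d n i)))"

(* Arguments: number of parameters, number of grid points, number of scalar components, the
   components, the parameter vector, the grid (all of the mode in question) and the channel. *)
definition sensitivity ::
  "nat \<Rightarrow> nat \<Rightarrow> nat \<Rightarrow> (nat \<Rightarrow> real vec \<Rightarrow> real \<Rightarrow> real) \<Rightarrow> real vec \<Rightarrow> (nat \<Rightarrow> real) \<Rightarrow> nat \<Rightarrow>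
   real mat" where
  "sensitivity Ps ns k f ths xs l = mat (ns * k) Ps (\<lambda>(c, p).
     (deriv ^^ l) (\<lambda>y. partial p (\<lambda>th. f (c mod k) th y) ths) (xs (c div k)))"

definition cp_sensitivity where
  "cp_sensitivity n x P R u \<theta> s l = sensitivity (P s) (n s) R (u s) (\<theta> s) (x s) l"

definition tt_sensitivity where
  "tt_sensitivity n x P r G \<theta> s l =
     sensitivity (P s) (n s) (r s * r (Suc s))
       (\<lambda>a th y. G s th y $$ (a div r (Suc s), a mod r (Suc s))) (\<theta> s) (x s) l"

(* The environments of mode s: entry at the multi-index j, of which the component j s is
   ignored, and at the rank index. *)

definition cp_env ::
  "nat \<Rightarrow> (nat \<Rightarrow> nat \<Rightarrow> real) \<Rightarrow> (nat \<Rightarrow> nat \<Rightarrow> real vec \<Rightarrow> real \<Rightarrow> real) \<Rightarrow> (nat \<Rightarrow> real vec) \<Rightarrow>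
   nat \<Rightarrow> nat \<Rightarrow> (nat \<Rightarrow> nat) \<Rightarrow> nat \<Rightarrow> real" where
  "cp_env d x u \<theta> s \<beta> j \<alpha> =
     (\<Prod>m\<in>{..<d} - {s}. mode_op \<beta> m (u m \<alpha> (\<theta> m)) (x m (j m)))"

definition tt_env ::
  "nat \<Rightarrow> (nat \<Rightarrow> nat \<Rightarrow> real) \<Rightarrow> (nat \<Rightarrow> nat) \<Rightarrow> (nat \<Rightarrow> real vec \<Rightarrow> real \<Rightarrow> real mat) \<Rightarrow>
   (nat \<Rightarrow> real vec) \<Rightarrow> nat \<Rightarrow> nat \<Rightarrow> (nat \<Rightarrow> nat) \<Rightarrow> nat \<Rightarrow> real" where
  "tt_env d x r G \<theta> s \<beta> j a =
     (let F = (\<lambda>m. entrywise (mode_op \<beta> m) (G m (\<theta> m)) (x m (j m)))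
      in mat_prod (r s) F 0 s $$ (0, a div r (Suc s)) *
         mat_prod 1 F (Suc s) d $$ (a mod r (Suc s), 0))"

(* E is the environment, k the number of rank indices of mode s. *)
definition direction_matrix ::
  "nat \<Rightarrow> (nat \<Rightarrow> nat) \<Rightarrow> nat \<Rightarrow> (nat \<Rightarrow> (nat \<Rightarrow> nat) \<Rightarrow> nat \<Rightarrow> real) \<Rightarrow> nat \<Rightarrow> nat \<Rightarrow>
   real mat" where
  "direction_matrix d n k E s l = mat (\<Prod>m<d. n m) (n s * k) (\<lambda>(i, c).
     of_bool (mi_digit d n i s = c div k) *
     (\<Sum>\<beta><d. chan_coeff s l \<beta> * E \<beta> (mi_digit d n i) (c mod k)))"

definition cp_direction where
  "cp_direction d n x R u \<theta> s l = direction_matrix d n R (cp_env d x u \<theta> s) s l"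

definition tt_direction where
  "tt_direction d n x r G \<theta> s l =
     direction_matrix d n (r s * r (Suc s)) (tt_env d x r G \<theta> s) s l"

definition append_cols :: "real mat \<Rightarrow> real mat \<Rightarrow> real mat" where
  "append_cols A B = four_block_mat A B (0\<^sub>m 0 (dim_col A)) (0\<^sub>m 0 (dim_col B))"

definition cp_Psi where
  "cp_Psi d n x R u \<theta> s =
     append_cols (cp_direction d n x R u \<theta> s 0) (cp_direction d n x R u \<theta> s 2)"

definition cp_C where
  "cp_C n x P R u \<theta> s =
     cp_sensitivity n x P R u \<theta> s 0 @\<^sub>r cp_sensitivity n x P R u \<theta> s 2"

definition tt_Psi where
  "tt_Psi d n x r G \<theta> s =
     append_cols (tt_direction d n x r G \<theta> s 0) (tt_direction d n x r G \<theta> s 2)"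

definition tt_C where
  "tt_C n x P r G \<theta> s =
     tt_sensitivity n x P r G \<theta> s 0 @\<^sub>r tt_sensitivity n x P r G \<theta> s 2"

(* The effective compressed dimension of a family of factorizations J s = Psi s * C s, s < d:
   the sum of the inner dimensions. *)
definition eff_dim :: "nat \<Rightarrow> (nat \<Rightarrow> real mat) \<Rightarrow> nat" where
  "eff_dim d Psi = (\<Sum>s<d. dim_col (Psi s))"

section \<open>Block transfer matrices for tensor trains\<close>

definition B_mat :: "(nat \<Rightarrow> real vec \<Rightarrow> real \<Rightarrow> real mat) \<Rightarrow> (nat \<Rightarrow> real vec) \<Rightarrow> nat \<Rightarrow> real \<Rightarrow>
    real mat" where
  "B_mat G \<theta> m y =
     (let Gm = G m (\<theta> m) y in
      four_block_mat Gm (- entrywise (deriv ^^ 2) (G m (\<theta> m)) y)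
        (0\<^sub>m (dim_row Gm) (dim_col Gm)) Gm)"

definition M_mat :: "nat \<Rightarrow> nat \<Rightarrow> nat \<Rightarrow> nat \<Rightarrow> real mat" where
  "M_mat p q a b = mat_of_cols p [unit_vec p a] * mat_of_row (unit_vec q b)"

(* p x q is the size of M_mat p q a b; the two channels are 0 and 2. *)
definition P_mat :: "nat \<Rightarrow> nat \<Rightarrow> nat \<Rightarrow> nat \<Rightarrow> nat \<Rightarrow> real mat" where
  "P_mat p q l a b =
     (if l = 0 then four_block_mat (M_mat p q a b) (0\<^sub>m p q) (0\<^sub>m p q) (M_mat p q a b)
      else four_block_mat (0\<^sub>m p q) (- M_mat p q a b) (0\<^sub>m p q) (0\<^sub>m p q))"

(* y is the point at which the functions are evaluated; Q_before only uses y m for m < s and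
   Q_after only uses y m for s < m < d. *)

definition Q_before :: "(nat \<Rightarrow> nat) \<Rightarrow> (nat \<Rightarrow> real vec \<Rightarrow> real \<Rightarrow> real mat) \<Rightarrow>
    (nat \<Rightarrow> real vec) \<Rightarrow> nat \<Rightarrow> (nat \<Rightarrow> real) \<Rightarrow> real mat" where
  "Q_before r G \<theta> s y =
     mat_of_rows_list 2 [[1, 0]] * mat_prod (2 * r s) (\<lambda>m. B_mat G \<theta> m (y m)) 0 s"

definition Q_after :: "nat \<Rightarrow> (nat \<Rightarrow> real vec \<Rightarrow> real \<Rightarrow> real mat) \<Rightarrow>
    (nat \<Rightarrow> real vec) \<Rightarrow> nat \<Rightarrow> (nat \<Rightarrow> real) \<Rightarrow> real mat" where
  "Q_after d G \<theta> s y =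
     mat_prod 2 (\<lambda>m. B_mat G \<theta> m (y m)) (Suc s) d * mat_of_cols_list 2 [[0, 1]]"

end

theory Submission
  imports Defs
begin

text \<open>
  In both formats the ansatz is linear in the scalar components of mode s, with coefficients that
  do not depend on the coordinate of mode s. Differentiating in a parameter of mode s replaces the
  component by its sensitivity; of the d second derivatives, the one in direction s then hits the
  sensitivity (channel 2) and all the others hit the coefficients (channel 0). In the tensor train
  case, the block triangular transfer matrices B carry the product of the cores on the diagonal and,
  in the upper right corner, the sum over all ways of applying the operator to exactly one core
  (a dual-number product), which gives the summed environments.
\<close>

section \<open>Functions that are twice differentiable on the unit interval\<close>

text \<open>Several notions of derivative have to meet. Parameter dependence is Frechet
  differentiability in the norm of H2(0,1), whereas the Jacobian blocks and the sensitivity matrices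
  take \<open>deriv\<close> of point values; the embedding into C[0,1] is proved because it turns a
  small H2 remainder into a small remainder at each point. Spatial regularity is one-sided on
  \<open>{0..1}\<close>, whereas \<open>deriv\<close> is two-sided, so derivatives are read off on
  \<open>{0<..<1}\<close> only. Moreover, the parameter derivative of the ansatz is identified only
  on the open cube, and the sizes of tensor train cores are known only for coordinates in
  \<open>{0..1}\<close>. An identity on an open interval determines all derivatives there, so each
  second derivative is computed after such a replacement. Since \<open>deriv\<close> has an
  unspecified value where no derivative exists, its values are always obtained from
  \<open>has_real_derivative\<close> facts.\<close>

lemma C2_unit_has_derivs:
  assumes "C2_unit f" "x \<in> {0<..<1}"
  shows "(f has_real_derivative deriv f x) (at x)"
    and "(deriv f has_real_derivative (deriv ^^ 2) f x) (at x)"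
proof -
  from assms(1) obtain f' f'' where D:
    "\<And>x. x \<in> {0..1} \<Longrightarrow> (f has_real_derivative f' x) (at x within {0..1})"
    "\<And>x. x \<in> {0..1} \<Longrightarrow> (f' has_real_derivative f'' x) (at x within {0..1})"
    unfolding C2_unit_def by blast
  have at: "at y within {0..1} = at y" if "y \<in> {0<..<1}" for y :: real
    using that by (intro at_within_interior) simp
  have f: "(f has_real_derivative f' y) (at y)" and f': "(f' has_real_derivative f'' y) (at y)"
    if "y \<in> {0<..<1}" for y
    using D[of y] that at[OF that] by auto
  \<comment> \<open>Agreement holds on the open interval only, the derivatives \<open>f'\<close>
    being one-sided at the ends. The open interval is a neighbourhood of \<open>x\<close>, so this
    suffices to transfer the derivative of \<open>f'\<close> to \<open>deriv f\<close>.\<close>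
  have eq: "deriv f y = f' y" if "y \<in> {0<..<1}" for y
    using f[OF that] by (rule DERIV_imp_deriv)
  show "(f has_real_derivative deriv f x) (at x)"
    using f eq assms(2) by simp
  have "\<forall>\<^sub>F y in nhds x. deriv f y = f' y"
    using assms(2) eq by (intro eventually_nhds_in_open[of "{0<..<1}", THEN eventually_mono]) auto
  then have "(deriv f has_real_derivative f'' x) (at x)"
    using f'[OF assms(2)] by (subst DERIV_cong_ev[OF refl _ refl])
  then show "(deriv f has_real_derivative (deriv ^^ 2) f x) (at x)"
    by (simp add: numeral_2_eq_2 DERIV_imp_deriv)
qed

text \<open>The second derivative at \<open>x\<close> depends on the first one near
  \<open>x\<close>; hence \<open>f'\<close> has to be a derivative on the whole interval, but is
  itself differentiated at \<open>x\<close> alone.\<close>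

lemma deriv2_unit_eqI:
  assumes "\<And>y. y \<in> {0<..<1} \<Longrightarrow> (f has_real_derivative f' y) (at y)"
    and "x \<in> {0<..<1}" "(f' has_real_derivative D) (at x)"
  shows "(deriv ^^ 2) f x = D"
proof -
  have "\<forall>\<^sub>F y in nhds x. deriv f y = f' y"
    using assms(1,2)
    by (intro eventually_nhds_in_open[of "{0<..<1}", THEN eventually_mono])
      (auto intro: DERIV_imp_deriv)
  then have "(deriv f has_real_derivative D) (at x)"
    using assms(3) by (subst DERIV_cong_ev[OF refl _ refl])
  then show ?thesis
    by (simp add: numeral_2_eq_2 DERIV_imp_deriv)
qed

lemma higher_deriv_unit_cong:
  assumes "\<And>y. y \<in> {0<..<1} \<Longrightarrow> f y = g y" "x \<in> {0<..<1}"
  shows "(deriv ^^ l) f x = (deriv ^^ l) g (x :: real)"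
  using assms
  by (intro higher_deriv_cong_ev refl eventually_nhds_in_open[of "{0<..<1}", THEN eventually_mono])
    auto

text \<open>One-sided derivatives do not see values outside \<open>{0..1}\<close>. This matters for
  tensor trains, where the expansion in the entries of a core is available only where its size is
  known.\<close>

lemma C2_unit_cong:
  assumes "C2_unit f" "\<And>x. x \<in> {0..1} \<Longrightarrow> f x = g x"
  shows "C2_unit g"
proof -
  from assms(1) obtain f' f'' where "continuous_on {0..1} f''" and D:
    "\<And>x. x \<in> {0..1} \<Longrightarrow> (f has_real_derivative f' x) (at x within {0..1})"
    "\<And>x. x \<in> {0..1} \<Longrightarrow> (f' has_real_derivative f'' x) (at x within {0..1})"
    unfolding C2_unit_def by blast
  moreover have "(g has_real_derivative f' x) (at x within {0..1})" if "x \<in> {0..1}" for x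
    using has_field_derivative_transform_within[OF D(1)[OF that], of 1 g] that assms(2) by simp
  ultimately show ?thesis
    unfolding C2_unit_def by blast
qed

lemma C2_unit_sum_mult:
  assumes "\<And>i. i \<in> I \<Longrightarrow> C2_unit (f i)"
  shows "C2_unit (\<lambda>x. \<Sum>i\<in>I. c i * f i x)"
proof -
  have "\<forall>i\<in>I. \<exists>f' f''. continuous_on {0..1} f'' \<and>
     (\<forall>x\<in>{0..1}. (f i has_real_derivative f' x) (at x within {0..1}) \<and>
                 (f' has_real_derivative f'' x) (at x within {0..1}))"
    using assms unfolding C2_unit_def by blast
  then obtain f' f'' where *: "\<forall>i\<in>I. continuous_on {0..1} (f'' i) \<and>
     (\<forall>x\<in>{0..1}. (f i has_real_derivative f' i x) (at x within {0..1}) \<and>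
                 (f' i has_real_derivative f'' i x) (at x within {0..1}))"
    by metis
  show ?thesis
    unfolding C2_unit_def
  proof (intro exI conjI ballI)
    show "continuous_on {0..1} (\<lambda>x. \<Sum>i\<in>I. c i * f'' i x)"
      using * by (intro continuous_intros) auto
    show "((\<lambda>x. \<Sum>i\<in>I. c i * f i x) has_real_derivative (\<Sum>i\<in>I. c i * f' i x))
        (at x within {0..1})"
      "((\<lambda>x. \<Sum>i\<in>I. c i * f' i x) has_real_derivative (\<Sum>i\<in>I. c i * f'' i x))
        (at x within {0..1})" if "x \<in> {0..1}" for x
      using * that by (auto intro!: DERIV_sum DERIV_cmult)
  qed
qed

lemma deriv2_sum_mult:
  assumes "\<And>i. i \<in> I \<Longrightarrow> C2_unit (f i)" "x \<in> {0<..<1}"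
  shows "(deriv ^^ 2) (\<lambda>x. \<Sum>i\<in>I. c i * f i x) x = (\<Sum>i\<in>I. c i * (deriv ^^ 2) (f i) x)"
proof (rule deriv2_unit_eqI[OF _ assms(2)])
  show "((\<lambda>x. \<Sum>i\<in>I. c i * f i x) has_real_derivative (\<Sum>i\<in>I. c i * deriv (f i) y)) (at y)"
    if "y \<in> {0<..<1}" for y
    using assms(1) that by (auto intro!: DERIV_sum DERIV_cmult C2_unit_has_derivs(1))
  show "((\<lambda>y. \<Sum>i\<in>I. c i * deriv (f i) y) has_real_derivative
      (\<Sum>i\<in>I. c i * (deriv ^^ 2) (f i) x)) (at x)"
    using assms by (auto intro!: DERIV_sum DERIV_cmult C2_unit_has_derivs(2))
qed

lemma C2_unit_mult:
  assumes "C2_unit f"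
  shows "C2_unit (\<lambda>x. c * f x)"
  using C2_unit_sum_mult[of "{()}" "\<lambda>_. f" "\<lambda>_. c"] assms by simp

lemma deriv2_mult:
  assumes "C2_unit f" "x \<in> {0<..<1}"
  shows "(deriv ^^ 2) (\<lambda>x. c * f x) x = c * (deriv ^^ 2) f x"
  using deriv2_sum_mult[of "{()}" "\<lambda>_. f" x "\<lambda>_. c"] assms by simp

lemma C2_unit_diff:
  assumes "C2_unit f" "C2_unit g"
  shows "C2_unit (\<lambda>x. f x - g x)"
  using C2_unit_sum_mult[of UNIV "\<lambda>b. if b then f else g" "\<lambda>b. if b then 1 else - 1"] assms
  by (simp add: UNIV_bool)

section \<open>Parameter derivatives\<close>

text \<open>
  The embedding of H2(0,1) into C[0,1]: take y where g^2 is minimal, so that its value there is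
  at most the mean of g^2, and integrate the derivative 2 g g' of g^2 from y to x.
\<close>
lemma abs_le_H2_norm:
  assumes "C2_unit g" "x \<in> {0..1}"
  shows "\<bar>g x\<bar> \<le> sqrt 2 * H2_norm g"
proof -
  from assms(1) obtain g' g'' where cont2: "continuous_on {0..1} g''" and D:
    "\<And>x. x \<in> {0..1} \<Longrightarrow> (g has_real_derivative g' x) (at x within {0..1})"
    "\<And>x. x \<in> {0..1} \<Longrightarrow> (g' has_real_derivative g'' x) (at x within {0..1})"
    unfolding C2_unit_def by blast
  have cont: "continuous_on {0..1} g" "continuous_on {0..1} g'"
    using D by (intro DERIV_continuous_on; blast)+
  define h where "h = (\<lambda>x. (g x)\<^sup>2 + (g' x)\<^sup>2 + (g'' x)\<^sup>2)"
  define I where "I = integral {0..1} h"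
  have cont_h: "continuous_on {0..1} h"
    unfolding h_def using cont cont2 by (intro continuous_intros)
  have int_h: "h integrable_on {a..b}" if "0 \<le> a" "b \<le> 1" for a b
    using that cont_h by (intro integrable_continuous_real continuous_on_subset[OF cont_h]) auto
  have at: "at y within {0..1} = at y" if "y \<in> {0<..<1}" for y :: real
    using that by (intro at_within_interior) simp
  have "deriv g y = g' y \<and> (deriv ^^ 2) g y = g'' y" if "y \<in> {0<..<1}" for y
  proof
    show "deriv g y = g' y"
      using D(1)[of y] at[OF that] that by (auto intro: DERIV_imp_deriv)
    show "(deriv ^^ 2) g y = g'' y"
      using D(2)[of y] at[OF that] that
    proof (intro deriv2_unit_eqI[OF _ that])
      show "(g has_real_derivative g' z) (at z)" if "z \<in> {0<..<1}" for z
        using D(1)[of z] at[OF that] that by auto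
    qed auto
  qed
  \<comment> \<open>The norm integrates over the open interval, exactly where \<open>deriv g\<close>
    and \<open>g'\<close> agree. Afterwards the integral of the continuous function \<open>h\<close>
    is passed to the closed interval.\<close>
  then have "(LINT x:{0<..<1}|lborel. (g x)\<^sup>2 + (deriv g x)\<^sup>2 + ((deriv ^^ 2) g x)\<^sup>2)
      = (LINT x:{0<..<1}|lborel. h x)"
    unfolding h_def by (intro set_lebesgue_integral_cong) auto
  also have "\<dots> = integral {0<..<1} h"
  proof (rule set_borel_integral_eq_integral)
    have "set_integrable lborel {0..1} h"
      using cont_h by (rule borel_integrable_atLeastAtMost')
    then show "set_integrable lborel {0<..<1} h"
      by (rule set_integrable_subset) auto
  qed
  also have "\<dots> = I"
    unfolding I_def by (rule integral_open_interval_real[symmetric])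
  finally have norm: "H2_norm g = sqrt I"
    unfolding H2_norm_def by simp
  obtain y where y: "y \<in> {0..1}" "\<And>t. t \<in> {0..1} \<Longrightarrow> (g y)\<^sup>2 \<le> (g t)\<^sup>2"
    using continuous_attains_inf[of "{0..1::real}" "\<lambda>t. (g t)\<^sup>2"]
      continuous_on_power[OF cont(1), of 2]
    by auto
  have "(g y)\<^sup>2 = integral {0..1::real} (\<lambda>_. (g y)\<^sup>2)"
    by simp
  also have "\<dots> \<le> I"
    unfolding I_def using y(2) int_h[of 0 1] by (intro integral_le) (auto simp: h_def add_increasing2)
  finally have gy: "(g y)\<^sup>2 \<le> I" .
  have diff: "\<bar>(g b)\<^sup>2 - (g a)\<^sup>2\<bar> \<le> I" if "0 \<le> a" "a \<le> b" "b \<le> 1" for a b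
  proof -
    have ftc: "((\<lambda>t. 2 * g t * g' t) has_integral ((g b)\<^sup>2 - (g a)\<^sup>2)) {a..b}"
    proof (rule fundamental_theorem_of_calculus[OF that(2)])
      fix t assume "t \<in> {a..b}"
      then have "(g has_real_derivative g' t) (at t within {a..b})"
        using that by (intro has_field_derivative_subset[OF D(1)]) auto
      then have "((\<lambda>t. (g t)\<^sup>2) has_real_derivative 2 * g t * g' t) (at t within {a..b})"
        by (auto intro!: derivative_eq_intros)
      then show "((\<lambda>t. (g t)\<^sup>2) has_vector_derivative 2 * g t * g' t) (at t within {a..b})"
        by (simp add: has_real_derivative_iff_has_vector_derivative)
    qed
    have "norm (integral {a..b} (\<lambda>t. 2 * g t * g' t)) \<le> integral {a..b} h"
    proof (rule integral_norm_bound_integral)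
      \<comment> \<open>The factor 2 from differentiating a square is absorbed by 2|ab| \<le> a^2 +
        b^2, so the increment of g^2 over any subinterval costs at most one
        \<open>I\<close>.\<close>
      show "norm (2 * g t * g' t) \<le> h t" for t
      proof -
        have "2 * \<bar>g t\<bar> * \<bar>g' t\<bar> \<le> (g t)\<^sup>2 + (g' t)\<^sup>2"
          using sum_squares_bound[of "\<bar>g t\<bar>" "\<bar>g' t\<bar>"] by simp
        then show ?thesis
          unfolding h_def by (simp add: abs_mult add_increasing2)
      qed
    qed (use ftc int_h that in auto)
    also have "\<dots> \<le> I"
      unfolding I_def using that by (intro integral_subset_le int_h) (auto simp: h_def)
    finally show ?thesis
      using ftc by (simp add: integral_unique)
  qed
  have "\<bar>(g x)\<^sup>2 - (g y)\<^sup>2\<bar> \<le> I"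
    using diff[of x y] diff[of y x] assms(2) y(1) by (cases "x \<le> y") auto
  \<comment> \<open>One \<open>I\<close> bounds the square at \<open>y\<close>, another one its
    increment from \<open>y\<close> to \<open>x\<close>: this is the origin of the constant
    \<open>sqrt 2\<close>.\<close>
  then have "(g x)\<^sup>2 \<le> 2 * I"
    using gy by linarith
  then show ?thesis
    unfolding norm by (metis real_sqrt_abs real_sqrt_le_iff real_sqrt_mult)
qed

lemma scalar_prod_smult_unit_vec:
  assumes "p < P"
  shows "scalar_prod (t \<cdot>\<^sub>v unit_vec P p) (t \<cdot>\<^sub>v unit_vec P p) = (t :: real)\<^sup>2"
  using assms by (simp add: power2_eq_square)

text \<open>Along the p-th coordinate ray the Frechet remainder is o(t) in the H2 norm, hence o(t)
  at each single point by \<open>abs_le_H2_norm\<close>. The pointwise parameter derivative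
  therefore exists and inherits the C2 regularity of \<open>w p\<close>.\<close>

lemma partial_H2_differentiable:
  assumes "admissible_factor P f" "th \<in> carrier_vec P"
  obtains w where "\<And>p. p < P \<Longrightarrow> C2_unit (w p)"
    "\<And>p y. p < P \<Longrightarrow> y \<in> {0<..<1} \<Longrightarrow>
       ((\<lambda>t. f (th + t \<cdot>\<^sub>v unit_vec P p) y) has_real_derivative w p y) (at 0)"
proof -
  from assms obtain w where C2: "\<And>p. p < P \<Longrightarrow> C2_unit (w p)"
    and lim: "\<And>\<epsilon>. \<epsilon> > 0 \<Longrightarrow> \<exists>\<delta>>0. \<forall>h\<in>carrier_vec P. sqrt (scalar_prod h h) < \<delta> \<longrightarrow>
        H2_norm (\<lambda>x. f (th + h) x - f th x - (\<Sum>p<P. h $ p * w p x))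
          \<le> \<epsilon> * sqrt (scalar_prod h h)"
    unfolding admissible_factor_def H2_differentiable_def by blast
  have "((\<lambda>t. f (th + t \<cdot>\<^sub>v unit_vec P p) y) has_real_derivative w p y) (at 0)"
    if p: "p < P" and y: "y \<in> {0<..<1}" for p y
    unfolding has_field_derivative_def has_derivative_at_alt
  proof (intro conjI allI impI bounded_linear_mult_right)
    fix e :: real assume "e > 0"
    \<comment> \<open>The tolerance \<open>e / sqrt 2\<close> cancels the embedding
      constant.\<close>
    then obtain \<delta> where \<delta>: "\<delta> > 0" "\<And>h. h \<in> carrier_vec P \<Longrightarrow> sqrt (scalar_prod h h) < \<delta> \<Longrightarrow>
        H2_norm (\<lambda>x. f (th + h) x - f th x - (\<Sum>p<P. h $ p * w p x))
          \<le> e / sqrt 2 * sqrt (scalar_prod h h)"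
      using lim[of "e / sqrt 2"] by auto
    have "norm (f (th + t \<cdot>\<^sub>v unit_vec P p) y - f (th + 0 \<cdot>\<^sub>v unit_vec P p) y - w p y * (t - 0))
        \<le> e * norm (t - 0)" if t: "norm (t - 0) < \<delta>" for t
    proof -
      define h where "h = t \<cdot>\<^sub>v unit_vec P p"
      define g where "g = (\<lambda>x. f (th + h) x - f th x - (\<Sum>p<P. h $ p * w p x))"
      have h: "h \<in> carrier_vec P" and hh: "sqrt (scalar_prod h h) = \<bar>t\<bar>"
        unfolding h_def using p by (auto simp: scalar_prod_smult_unit_vec)
      have "C2_unit (f (th + h))" "C2_unit (f th)"
        using assms h unfolding admissible_factor_def by auto
      then have "C2_unit g"
        unfolding g_def using C2 by (intro C2_unit_diff C2_unit_sum_mult) auto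
      then have "\<bar>g y\<bar> \<le> sqrt 2 * H2_norm g"
        using y by (intro abs_le_H2_norm) auto
      also have "H2_norm g \<le> e / sqrt 2 * \<bar>t\<bar>"
        using \<delta>(2)[OF h] hh t unfolding g_def by simp
      finally have "\<bar>g y\<bar> \<le> e * \<bar>t\<bar>"
        by simp
      moreover have "(\<Sum>q<P. h $ q * w q y) = (\<Sum>q<P. if q = p then t * w q y else 0)"
        unfolding h_def using p by (intro sum.cong) auto
      then have "(\<Sum>q<P. h $ q * w q y) = t * w p y"
        using p by simp
      moreover have "th + 0 \<cdot>\<^sub>v unit_vec P p = th"
        using assms(2) by auto
      ultimately show ?thesis
        unfolding g_def h_def by (simp add: mult.commute)
    qed
    then show "\<exists>d>0. \<forall>t. norm (t - 0) < d \<longrightarrow>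
        norm (f (th + t \<cdot>\<^sub>v unit_vec P p) y - f (th + 0 \<cdot>\<^sub>v unit_vec P p) y - w p y * (t - 0))
          \<le> e * norm (t - 0)"
      using \<delta>(1) by blast
  qed
  then show thesis
    using C2 that by blast
qed

section \<open>Factorization of the Jacobian blocks\<close>

definition vec_upd :: "'a vec \<Rightarrow> nat \<Rightarrow> 'a \<Rightarrow> 'a vec" where
  "vec_upd z i y = vec (dim_vec z) (\<lambda>m. if m = i then y else z $ m)"

lemma dim_vec_upd [simp]: "dim_vec (vec_upd z i y) = dim_vec z"
  and index_vec_upd [simp]: "m < dim_vec z \<Longrightarrow> vec_upd z i y $ m = (if m = i then y else z $ m)"
  by (simp_all add: vec_upd_def)

lemma vec_upd_twice [simp]: "vec_upd (vec_upd z i y) i y' = vec_upd z i y'"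
  by (rule eq_vecI) auto

lemma deriv_shift: "deriv f (a + b) = deriv (\<lambda>t. f (a + t)) (b :: real)"
  unfolding deriv_def using DERIV_shift[of f _ b a] by (simp add: add.commute)

text \<open>A shift of the variable replaces translation along a unit vector by assignment of a
  coordinate, so that the differentiated function depends on \<open>z\<close> only through its other
  coordinates. In this form the derivative can be iterated.\<close>

lemma partial_eq_deriv_vec_upd:
  assumes "\<beta> < dim_vec z"
  shows "partial \<beta> f z = deriv (\<lambda>y. f (vec_upd z \<beta> y)) (z $ \<beta>)"
proof -
  have "z + t \<cdot>\<^sub>v unit_vec (dim_vec z) \<beta> = vec_upd z \<beta> (z $ \<beta> + t)" for t
    using assms by (intro eq_vecI) (auto simp: unit_vec_def)
  then show ?thesis
    unfolding partial_def using deriv_shift[of "\<lambda>y. f (vec_upd z \<beta> y)" "z $ \<beta>" 0] by simp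
qed

text \<open>All points of a coordinate slice have the same slice (\<open>vec_upd_twice\<close>), so
  the inner partial derivative is the derivative of one fixed function of one variable.\<close>

lemma partial_partial_eq_deriv2:
  assumes "\<beta> < dim_vec z"
  shows "partial \<beta> (partial \<beta> f) z = (deriv ^^ 2) (\<lambda>y. f (vec_upd z \<beta> y)) (z $ \<beta>)"
  using assms by (simp add: partial_eq_deriv_vec_upd numeral_2_eq_2)

text \<open>Openness in every coordinate is what allows identities on this set to be differentiated;
  the dimension is part of the condition because a \<open>vec\<close> carries its own
  length.\<close>

definition open_cube :: "nat \<Rightarrow> real vec set" where
  "open_cube d = {z. dim_vec z = d \<and> (\<forall>m<d. z $ m \<in> {0<..<1})}"

lemma vec_upd_open_cube:
  "z \<in> open_cube d \<Longrightarrow> y \<in> {0<..<1} \<Longrightarrow> vec_upd z \<beta> y \<in> open_cube d"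
  by (auto simp: open_cube_def)

text \<open>Each second partial derivative only sees a coordinate slice, and on every slice through
  \<open>z\<close> the two functions agree on all of \<open>{0<..<1}\<close>, a neighbourhood of the
  coordinate of \<open>z\<close>.\<close>

lemma neg_laplacian_cong:
  assumes "\<And>z. z \<in> open_cube d \<Longrightarrow> f z = g z" "z \<in> open_cube d"
  shows "neg_laplacian f z = neg_laplacian g z"
proof -
  have dim: "dim_vec z = d"
    using assms(2) by (simp add: open_cube_def)
  have "partial \<beta> (partial \<beta> f) z = partial \<beta> (partial \<beta> g) z" if "\<beta> < d" for \<beta>
  proof -
    have "z $ \<beta> \<in> {0<..<1}"
      using assms(2) that by (auto simp: open_cube_def)
    then show ?thesis
      unfolding partial_partial_eq_deriv2[OF that[folded dim]]
      using assms by (intro higher_deriv_unit_cong assms(1) vec_upd_open_cube)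
  qed
  then show ?thesis
    unfolding neg_laplacian_def dim by simp
qed

text \<open>Cutting the index range into \<open>n\<close> blocks of length \<open>k\<close>, the
  Kronecker delta keeps block \<open>j\<close> only. This is a row of
  \<open>direction_matrix\<close> times a column of \<open>sensitivity\<close>.\<close>

lemma sum_channel:
  fixes h :: "nat \<Rightarrow> real"
  assumes "j < n"
  shows "(\<Sum>c<n * k. of_bool (j = c div k) * g (c mod k) * h c)
    = (\<Sum>a<k. g a * h (pair_pos k j a))"
proof -
  have "(\<Sum>c<n * k. of_bool (j = c div k) * g (c mod k) * h c)
      = (\<Sum>m<n. \<Sum>c\<in>{m * k..<m * k + k}. of_bool (j = c div k) * g (c mod k) * h c)"
    by (rule sum.nat_group[symmetric])
  also have "\<dots> = (\<Sum>m<n. if m = j then \<Sum>a<k. g a * h (pair_pos k j a) else 0)"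
  proof (rule sum.cong[OF refl])
    fix m
    have "(\<Sum>c\<in>{m * k..<m * k + k}. of_bool (j = c div k) * g (c mod k) * h c)
        = (\<Sum>c\<in>{0 + m * k..<k + m * k}. of_bool (j = c div k) * g (c mod k) * h c)"
      by (simp add: add.commute)
    also have "\<dots>
        = (\<Sum>a\<in>{0..<k}. of_bool (j = (a + m * k) div k) * g ((a + m * k) mod k) * h (a + m * k))"
      by (rule sum.shift_bounds_nat_ivl)
    also have "\<dots> = (\<Sum>a\<in>{0..<k}. if m = j then g a * h (pair_pos k j a) else 0)"
      by (intro sum.cong) (auto simp: pair_pos_def add.commute)
    finally show "(\<Sum>c\<in>{m * k..<m * k + k}. of_bool (j = c div k) * g (c mod k) * h c)
        = (if m = j then \<Sum>a<k. g a * h (pair_pos k j a) else 0)"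
      by (simp add: lessThan_atLeast0)
  qed
  finally show ?thesis
    using assms by simp
qed

lemma pair_pos_less: "j < n \<Longrightarrow> a < k \<Longrightarrow> pair_pos k j a < n * k"
proof -
  assume "j < n" "a < k"
  then have "j * k + a < Suc j * k" "Suc j * k \<le> n * k"
    by (simp, intro mult_le_mono1) simp
  then show ?thesis
    unfolding pair_pos_def by linarith
qed

lemma pair_pos_div [simp]: "a < k \<Longrightarrow> pair_pos k j a div k = j"
  and pair_pos_mod [simp]: "a < k \<Longrightarrow> pair_pos k j a mod k = a"
  by (simp_all add: pair_pos_def)

text \<open>Both concatenations are four-block matrices with empty blocks: no lower rows on the
  left, no right columns on the right. Block multiplication then leaves a single nonempty
  block.\<close>

lemma append_cols_mult_append_rows:
  assumes "A \<in> carrier_mat N K" "B \<in> carrier_mat N K'" "C \<in> carrier_mat K q" "D \<in> carrier_mat K' q"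
  shows "append_cols A B * (C @\<^sub>r D) = A * C + B * D"
proof -
  have "append_cols A B * (C @\<^sub>r D)
      = four_block_mat (A * C + B * D) (A * 0\<^sub>m K 0 + B * 0\<^sub>m K' 0)
          (0\<^sub>m 0 K * C + 0\<^sub>m 0 K' * D) (0\<^sub>m 0 K * 0\<^sub>m K 0 + 0\<^sub>m 0 K' * 0\<^sub>m K' 0)"
    unfolding append_cols_def append_rows_def using assms
    by (subst mult_four_block_mat[of _ N K _ K' _ 0 _ _ q _ 0]) auto
  also have "\<dots> = A * C + B * D"
    using assms by (intro eq_matI) auto
  finally show ?thesis .
qed

text \<open>A digit is a remainder modulo \<open>n m\<close>, and \<open>n m\<close> is positive
  because an index below a product excludes zero factors.\<close>

lemma mi_digit_less:
  assumes "i < (\<Prod>m<d. n m)" "m < d"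
  shows "mi_digit d n i m < n m"
proof -
  have "n m > 0"
    using assms by (metis finite_lessThan lessThan_iff gr0I not_less_zero prod_zero)
  then show ?thesis
    by (simp add: mi_digit_def)
qed

text \<open>Both formats are of this form, with f c the scalar components of mode s.\<close>
lemma jacobian_block_factorization:
  fixes f :: "nat \<Rightarrow> real vec \<Rightarrow> real \<Rightarrow> real" and E :: "nat \<Rightarrow> real vec \<Rightarrow> real"
  assumes s: "s < d"
    and grid: "\<And>m j. m < d \<Longrightarrow> j < n m \<Longrightarrow> x m j \<in> {0<..<1}"
    and \<theta>: "\<theta> s \<in> carrier_vec (P s)"
    and f: "\<And>c. c < k \<Longrightarrow> admissible_factor (P s) (f c)"
    and U: "\<And>th z. th \<in> carrier_vec (P s) \<Longrightarrow> z \<in> open_cube d \<Longrightarrow>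
      U (\<theta>(s := th)) z = (\<Sum>c<k. E c z * f c th (z $ s))"
    and E_s: "\<And>c z y. c < k \<Longrightarrow> z \<in> open_cube d \<Longrightarrow> y \<in> {0<..<1} \<Longrightarrow> E c (vec_upd z s y) = E c z"
    and E_C2: "\<And>c z \<beta>. c < k \<Longrightarrow> z \<in> open_cube d \<Longrightarrow> \<beta> < d \<Longrightarrow> \<beta> \<noteq> s \<Longrightarrow>
      C2_unit (\<lambda>y. E c (vec_upd z \<beta> y))"
    and env_s: "\<And>c j. c < k \<Longrightarrow> (\<And>m. m < d \<Longrightarrow> j m < n m) \<Longrightarrow>
      Env s j c = E c (grid_point d x j)"
    and env: "\<And>c j \<beta>. c < k \<Longrightarrow> (\<And>m. m < d \<Longrightarrow> j m < n m) \<Longrightarrow> \<beta> < d \<Longrightarrow> \<beta> \<noteq> s \<Longrightarrow>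
      Env \<beta> j c = - (deriv ^^ 2) (\<lambda>y. E c (vec_upd (grid_point d x j) \<beta> y)) (x \<beta> (j \<beta>))"
  shows "jacobian_block d n x P U \<theta> s
    = append_cols (direction_matrix d n k Env s 0) (direction_matrix d n k Env s 2) *
      (sensitivity (P s) (n s) k f (\<theta> s) (x s) 0 @\<^sub>r sensitivity (P s) (n s) k f (\<theta> s) (x s) 2)"
    (is "_ = append_cols ?D0 ?D2 * (?H0 @\<^sub>r ?H2)")
proof -
  have "\<exists>w. \<forall>p<P s. C2_unit (w p) \<and> (\<forall>y\<in>{0<..<1}.
      ((\<lambda>t. f c (\<theta> s + t \<cdot>\<^sub>v unit_vec (P s) p) y) has_real_derivative w p y) (at 0))"
    if "c < k" for c
    using partial_H2_differentiable[OF f[OF that] \<theta>] by metis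
  then obtain w where w_C2: "\<And>c p. c < k \<Longrightarrow> p < P s \<Longrightarrow> C2_unit (w c p)"
    and w: "\<And>c p y. c < k \<Longrightarrow> p < P s \<Longrightarrow> y \<in> {0<..<1} \<Longrightarrow>
      ((\<lambda>t. f c (\<theta> s + t \<cdot>\<^sub>v unit_vec (P s) p) y) has_real_derivative w c p y) (at 0)"
    by metis
  have dim_\<theta>: "dim_vec (\<theta> s) = P s"
    using \<theta> by auto
  have partial_U: "partial p (\<lambda>th. U (\<theta>(s := th)) z) (\<theta> s) = (\<Sum>c<k. E c z * w c p (z $ s))"
    if "p < P s" "z \<in> open_cube d" for p z
  proof -
    have "\<theta> s + t \<cdot>\<^sub>v unit_vec (P s) p \<in> carrier_vec (P s)" for t
      using \<theta> by auto
    then have "partial p (\<lambda>th. U (\<theta>(s := th)) z) (\<theta> s)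
        = deriv (\<lambda>t. \<Sum>c<k. E c z * f c (\<theta> s + t \<cdot>\<^sub>v unit_vec (P s) p) (z $ s)) 0"
      unfolding partial_def dim_\<theta> using that by (simp add: U)
    also have "\<dots> = (\<Sum>c<k. E c z * w c p (z $ s))"
      using that s by (intro DERIV_imp_deriv DERIV_sum DERIV_cmult w) (auto simp: open_cube_def)
    finally show ?thesis .
  qed
  \<comment> \<open>Parameter derivative and \<open>w c p\<close> agree on the whole open interval,
    so their spatial derivatives of every order agree there; channel \<open>l\<close> of the
    sensitivity is thus a derivative of \<open>w c p\<close>.\<close>
  have partial_f: "(deriv ^^ l) (\<lambda>y. partial p (\<lambda>th. f c th y) (\<theta> s)) y = (deriv ^^ l) (w c p) y"
    if "c < k" "p < P s" "y \<in> {0<..<1}" for c p y l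
    unfolding partial_def dim_\<theta>
    using that by (intro higher_deriv_unit_cong DERIV_imp_deriv w)
  have entry: "neg_laplacian (\<lambda>z. partial p (\<lambda>th. U (\<theta>(s := th)) z) (\<theta> s)) (grid_point d x j)
      = (\<Sum>c<k. (\<Sum>\<beta>\<in>{..<d} - {s}. Env \<beta> j c) * w c p (x s (j s))) +
        (\<Sum>c<k. - Env s j c * (deriv ^^ 2) (w c p) (x s (j s)))"
    if p: "p < P s" and j: "\<And>m. m < d \<Longrightarrow> j m < n m" for p j
  proof -
    define z where "z = grid_point d x j"
    define g where "g = (\<lambda>z. \<Sum>c<k. E c z * w c p (z $ s))"
    have dim: "dim_vec z = d" and z_nth: "\<And>m. m < d \<Longrightarrow> z $ m = x m (j m)"
      by (simp_all add: z_def grid_point_def)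
    have z: "z \<in> open_cube d"
      using grid j unfolding open_cube_def by (simp add: dim z_nth)
    have x_unit: "x m (j m) \<in> {0<..<1}" if "m < d" for m
      using grid j that by auto
    \<comment> \<open>The coefficients \<open>E c\<close> are constant along coordinate
      \<open>s\<close> by \<open>E_s\<close>, so both derivatives fall on
      \<open>w c p\<close>.\<close>
    have s_term: "partial s (partial s g) z
        = (\<Sum>c<k. Env s j c * (deriv ^^ 2) (w c p) (x s (j s)))"
    proof -
      have "partial s (partial s g) z
          = (deriv ^^ 2) (\<lambda>y. \<Sum>c<k. E c z * w c p y) (x s (j s))"
        unfolding partial_partial_eq_deriv2[OF s[folded dim]] z_nth[OF s] g_def
        using z dim s x_unit by (intro higher_deriv_unit_cong sum.cong) (auto simp: E_s)
      also have "\<dots> = (\<Sum>c<k. E c z * (deriv ^^ 2) (w c p) (x s (j s)))"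
        using w_C2 p x_unit s by (intro deriv2_sum_mult) auto
      finally show ?thesis
        using env_s j by (simp add: z_def)
    qed
    \<comment> \<open>Now \<open>w c p\<close> is the constant and \<open>E c\<close> is
      differentiated. The minus sign arises because \<open>Env \<beta>\<close> already contains the
      sign of the operator.\<close>
    have \<beta>_term: "partial \<beta> (partial \<beta> g) z = - (\<Sum>c<k. Env \<beta> j c * w c p (x s (j s)))"
      if \<beta>: "\<beta> \<in> {..<d} - {s}" for \<beta>
    proof -
      have "partial \<beta> (partial \<beta> g) z
          = (deriv ^^ 2) (\<lambda>y. \<Sum>c<k. w c p (x s (j s)) * E c (vec_upd z \<beta> y)) (x \<beta> (j \<beta>))"
        using \<beta> dim s z_nth by (simp add: partial_partial_eq_deriv2 g_def mult.commute)
      also have "\<dots> = (\<Sum>c<k. w c p (x s (j s)) *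
          (deriv ^^ 2) (\<lambda>y. E c (vec_upd z \<beta> y)) (x \<beta> (j \<beta>)))"
        using E_C2 z x_unit \<beta> by (intro deriv2_sum_mult) auto
      finally show ?thesis
        using env j \<beta> by (simp add: z_def sum_negf mult.commute)
    qed
    have "neg_laplacian (\<lambda>z. partial p (\<lambda>th. U (\<theta>(s := th)) z) (\<theta> s)) z = neg_laplacian g z"
      using p z by (intro neg_laplacian_cong) (auto simp: partial_U g_def)
    \<comment> \<open>The outer minus cancels the sign of the terms with \<beta> different from
      \<open>s\<close>, but survives for \<beta> = \<open>s\<close>. These are precisely the channel
      coefficients: 1 off the diagonal in channel 0, and -1 on it in channel 2.\<close>
    also have "\<dots> = - partial s (partial s g) z - (\<Sum>\<beta>\<in>{..<d} - {s}. partial \<beta> (partial \<beta> g) z)"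
      unfolding neg_laplacian_def dim using s by (simp add: sum.remove)
    also have "\<dots> = (\<Sum>\<beta>\<in>{..<d} - {s}. \<Sum>c<k. Env \<beta> j c * w c p (x s (j s))) +
        (\<Sum>c<k. - Env s j c * (deriv ^^ 2) (w c p) (x s (j s)))"
      using \<beta>_term s_term by (simp add: sum_negf)
    finally show ?thesis
      unfolding z_def by (simp add: sum_distrib_right sum.swap[of _ "{..<k}"])
  qed
  have coeff0: "(\<Sum>\<beta><d. chan_coeff s 0 \<beta> * Env \<beta> j a) = (\<Sum>\<beta>\<in>{..<d} - {s}. Env \<beta> j a)" for j a
    using s by (simp add: chan_coeff_def sum.remove)
  have coeff2: "(\<Sum>\<beta><d. chan_coeff s 2 \<beta> * Env \<beta> j a) = - Env s j a" for j a
    using s by (simp add: chan_coeff_def sum.remove)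
  show ?thesis
  proof (subst append_cols_mult_append_rows)
    show "jacobian_block d n x P U \<theta> s = ?D0 * ?H0 + ?D2 * ?H2"
    proof (rule eq_matI)
      fix i p
      assume "i < dim_row (?D0 * ?H0 + ?D2 * ?H2)" "p < dim_col (?D0 * ?H0 + ?D2 * ?H2)"
      then have i: "i < (\<Prod>m<d. n m)" and p: "p < P s"
        by (auto simp: direction_matrix_def sensitivity_def)
      define j where "j = mi_digit d n i"
      have j: "j m < n m" if "m < d" for m
        unfolding j_def using i that by (rule mi_digit_less)
      have prod: "(direction_matrix d n k Env s l * sensitivity (P s) (n s) k f (\<theta> s) (x s) l) $$ (i, p)
          = (\<Sum>a<k. (\<Sum>\<beta><d. chan_coeff s l \<beta> * Env \<beta> j a) * (deriv ^^ l) (w a p) (x s (j s)))"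
        for l
      proof -
        have "(direction_matrix d n k Env s l * sensitivity (P s) (n s) k f (\<theta> s) (x s) l) $$ (i, p)
            = (\<Sum>c<n s * k. of_bool (j s = c div k) *
                (\<Sum>\<beta><d. chan_coeff s l \<beta> * Env \<beta> j (c mod k)) *
                (deriv ^^ l) (\<lambda>y. partial p (\<lambda>th. f (c mod k) th y) (\<theta> s)) (x s (c div k)))"
          using i p by (simp add: direction_matrix_def sensitivity_def scalar_prod_def j_def
              lessThan_atLeast0)
        also have "\<dots> = (\<Sum>a<k. (\<Sum>\<beta><d. chan_coeff s l \<beta> * Env \<beta> j a) *
            (deriv ^^ l) (\<lambda>y. partial p (\<lambda>th. f (pair_pos k (j s) a mod k) th y) (\<theta> s))
              (x s (pair_pos k (j s) a div k)))"
          using j[OF s] by (rule sum_channel)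
        also have "\<dots> = (\<Sum>a<k. (\<Sum>\<beta><d. chan_coeff s l \<beta> * Env \<beta> j a) *
            (deriv ^^ l) (w a p) (x s (j s)))"
          using grid[OF s j[OF s]] p by (intro sum.cong) (auto simp: partial_f)
        finally show ?thesis .
      qed
      have "jacobian_block d n x P U \<theta> s $$ (i, p)
          = (?D0 * ?H0) $$ (i, p) + (?D2 * ?H2) $$ (i, p)"
        unfolding prod coeff0 coeff2 using i p entry[OF p, of j] j
        by (simp add: jacobian_block_def j_def)
      also have "\<dots> = (?D0 * ?H0 + ?D2 * ?H2) $$ (i, p)"
        using i p by (subst index_add_mat) (auto simp: direction_matrix_def sensitivity_def)
      finally show "jacobian_block d n x P U \<theta> s $$ (i, p) = (?D0 * ?H0 + ?D2 * ?H2) $$ (i, p)" .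
    qed (auto simp: jacobian_block_def direction_matrix_def sensitivity_def)
  qed (auto simp: direction_matrix_def sensitivity_def)
qed

section \<open>The CP format\<close>

lemma cp_eval_split:
  assumes "s < d"
  shows "cp_eval d R u (\<theta>(s := th)) z
    = (\<Sum>\<alpha><R. (\<Prod>m\<in>{..<d} - {s}. u m \<alpha> (\<theta> m) (z $ m)) * u s \<alpha> th (z $ s))"
  unfolding cp_eval_def
proof (rule sum.cong[OF refl])
  fix \<alpha>
  have "(\<Prod>m<d. u m \<alpha> ((\<theta>(s := th)) m) (z $ m))
      = u s \<alpha> th (z $ s) * (\<Prod>m\<in>{..<d} - {s}. u m \<alpha> ((\<theta>(s := th)) m) (z $ m))"
    using assms by (simp add: prod.remove)
  also have "(\<Prod>m\<in>{..<d} - {s}. u m \<alpha> ((\<theta>(s := th)) m) (z $ m))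
      = (\<Prod>m\<in>{..<d} - {s}. u m \<alpha> (\<theta> m) (z $ m))"
    by (intro prod.cong) auto
  finally show "(\<Prod>m<d. u m \<alpha> ((\<theta>(s := th)) m) (z $ m))
      = (\<Prod>m\<in>{..<d} - {s}. u m \<alpha> (\<theta> m) (z $ m)) * u s \<alpha> th (z $ s)"
    by (simp add: mult.commute)
qed

lemma cp_env_same:
  "cp_env d x u \<theta> s s j \<alpha> = (\<Prod>m\<in>{..<d} - {s}. u m \<alpha> (\<theta> m) (x m (j m)))"
  unfolding cp_env_def mode_op_def by (intro prod.cong) auto

lemma cp_env_other:
  assumes "\<beta> < d" "\<beta> \<noteq> s"
  shows "cp_env d x u \<theta> s \<beta> j \<alpha> = - ((deriv ^^ 2) (u \<beta> \<alpha> (\<theta> \<beta>)) (x \<beta> (j \<beta>)) *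
    (\<Prod>m\<in>{..<d} - {s, \<beta>}. u m \<alpha> (\<theta> m) (x m (j m))))"
proof -
  have "{..<d} - {s} - {\<beta>} = {..<d} - {s, \<beta>}"
    by auto
  then have "cp_env d x u \<theta> s \<beta> j \<alpha> = mode_op \<beta> \<beta> (u \<beta> \<alpha> (\<theta> \<beta>)) (x \<beta> (j \<beta>)) *
      (\<Prod>m\<in>{..<d} - {s, \<beta>}. mode_op \<beta> m (u m \<alpha> (\<theta> m)) (x m (j m)))"
    unfolding cp_env_def using assms by (subst prod.remove[of _ \<beta>]) auto
  also have "(\<Prod>m\<in>{..<d} - {s, \<beta>}. mode_op \<beta> m (u m \<alpha> (\<theta> m)) (x m (j m)))
      = (\<Prod>m\<in>{..<d} - {s, \<beta>}. u m \<alpha> (\<theta> m) (x m (j m)))"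
    unfolding mode_op_def by (intro prod.cong) auto
  finally show ?thesis
    by (simp add: mode_op_def)
qed

text \<open>The coefficient of the component \<open>u s \<alpha>\<close> is the product of the
  factors of the other modes. As a function of one coordinate \<beta> different from
  \<open>s\<close> it is a constant multiple of \<open>u \<beta> \<alpha>\<close>, so its second
  derivative is again a product, with that single factor differentiated.\<close>

lemma cp_factorization:
  assumes s: "s < d"
    and grid: "\<And>m j. m < d \<Longrightarrow> j < n m \<Longrightarrow> x m j \<in> {0<..<1}"
    and param: "\<And>m. m < d \<Longrightarrow> \<theta> m \<in> carrier_vec (P m)"
    and ansatz: "cp_ansatz d R P u"
  shows "jacobian_block d n x P (cp_eval d R u) \<theta> s = cp_Psi d n x R u \<theta> s * cp_C n x P R u \<theta> s"
  unfolding cp_Psi_def cp_C_def cp_direction_def cp_sensitivity_def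
proof (rule jacobian_block_factorization
    [where E = "\<lambda>\<alpha> z. \<Prod>m\<in>{..<d} - {s}. u m \<alpha> (\<theta> m) (z $ m)" and x = x and P = P and \<theta> = \<theta>,
      OF s grid param[OF s]])
  have C2: "C2_unit (u m \<alpha> (\<theta> m))" if "m < d" "\<alpha> < R" for m \<alpha>
    using ansatz param that unfolding cp_ansatz_def admissible_factor_def by blast
  have slice: "(\<Prod>m\<in>{..<d} - {s}. u m \<alpha> (\<theta> m) (vec_upd z \<beta> y $ m))
      = (\<Prod>m\<in>{..<d} - {s, \<beta>}. u m \<alpha> (\<theta> m) (z $ m)) * u \<beta> \<alpha> (\<theta> \<beta>) y"
    if "dim_vec z = d" "\<beta> < d" "\<beta> \<noteq> s" for \<alpha> z \<beta> y
  proof -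
    have "{..<d} - {s} - {\<beta>} = {..<d} - {s, \<beta>}"
      by auto
    then have "(\<Prod>m\<in>{..<d} - {s}. u m \<alpha> (\<theta> m) (vec_upd z \<beta> y $ m))
        = u \<beta> \<alpha> (\<theta> \<beta>) y * (\<Prod>m\<in>{..<d} - {s, \<beta>}. u m \<alpha> (\<theta> m) (vec_upd z \<beta> y $ m))"
      using that by (subst prod.remove[of _ \<beta>]) auto
    also have "(\<Prod>m\<in>{..<d} - {s, \<beta>}. u m \<alpha> (\<theta> m) (vec_upd z \<beta> y $ m))
        = (\<Prod>m\<in>{..<d} - {s, \<beta>}. u m \<alpha> (\<theta> m) (z $ m))"
      using that by (intro prod.cong) auto
    finally show ?thesis
      by (simp add: mult.commute)
  qed
  show "admissible_factor (P s) (u s \<alpha>)" if "\<alpha> < R" for \<alpha>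
    using ansatz that s unfolding cp_ansatz_def by blast
  show "cp_eval d R u (\<theta>(s := th)) z
      = (\<Sum>\<alpha><R. (\<Prod>m\<in>{..<d} - {s}. u m \<alpha> (\<theta> m) (z $ m)) * u s \<alpha> th (z $ s))" for th z
    using s by (rule cp_eval_split)
  show "(\<Prod>m\<in>{..<d} - {s}. u m \<alpha> (\<theta> m) (vec_upd z s y $ m))
      = (\<Prod>m\<in>{..<d} - {s}. u m \<alpha> (\<theta> m) (z $ m))" if "z \<in> open_cube d" for \<alpha> z y
    using that by (intro prod.cong) (auto simp: open_cube_def)
  show "C2_unit (\<lambda>y. \<Prod>m\<in>{..<d} - {s}. u m \<alpha> (\<theta> m) (vec_upd z \<beta> y $ m))"
    if "\<alpha> < R" "z \<in> open_cube d" "\<beta> < d" "\<beta> \<noteq> s" for \<alpha> z \<beta>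
  proof -
    have dim: "dim_vec z = d"
      using that by (simp add: open_cube_def)
    show ?thesis
      unfolding slice[OF dim that(3,4)] using that by (intro C2_unit_mult C2)
  qed
  show "cp_env d x u \<theta> s s j \<alpha> = (\<Prod>m\<in>{..<d} - {s}. u m \<alpha> (\<theta> m) (grid_point d x j $ m))" for \<alpha> j
    unfolding cp_env_same by (intro prod.cong) (auto simp: grid_point_def)
  show "cp_env d x u \<theta> s \<beta> j \<alpha> = - (deriv ^^ 2) (\<lambda>y.
      \<Prod>m\<in>{..<d} - {s}. u m \<alpha> (\<theta> m) (vec_upd (grid_point d x j) \<beta> y $ m)) (x \<beta> (j \<beta>))"
    if "\<alpha> < R" "\<And>m. m < d \<Longrightarrow> j m < n m" "\<beta> < d" "\<beta> \<noteq> s" for \<alpha> j \<beta>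
  proof -
    have dim: "dim_vec (grid_point d x j) = d"
      by (simp add: grid_point_def)
    have "(deriv ^^ 2) (\<lambda>y.
        \<Prod>m\<in>{..<d} - {s}. u m \<alpha> (\<theta> m) (vec_upd (grid_point d x j) \<beta> y $ m)) (x \<beta> (j \<beta>))
      = (\<Prod>m\<in>{..<d} - {s, \<beta>}. u m \<alpha> (\<theta> m) (grid_point d x j $ m)) *
        (deriv ^^ 2) (u \<beta> \<alpha> (\<theta> \<beta>)) (x \<beta> (j \<beta>))"
      unfolding slice[OF dim that(3,4)] using that grid by (intro deriv2_mult C2) auto
    also have "(\<Prod>m\<in>{..<d} - {s, \<beta>}. u m \<alpha> (\<theta> m) (grid_point d x j $ m))
        = (\<Prod>m\<in>{..<d} - {s, \<beta>}. u m \<alpha> (\<theta> m) (x m (j m)))"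
      by (intro prod.cong) (auto simp: grid_point_def)
    finally show ?thesis
      using that by (simp add: cp_env_other mult.commute)
  qed
qed

text \<open>The matrix reads its row index through \<open>mi_digit\<close>, which recovers
  \<open>i\<close> from \<open>mi_pos\<close> only below \<open>d\<close>. Hence the condition that
  \<open>E\<close> depends on nothing beyond these components.\<close>

lemma direction_matrix_entry:
  assumes "\<And>m. m < d \<Longrightarrow> i m < n m" "s < d" "j < n s" "a < k"
    and "\<And>\<beta> i'. (\<And>m. m < d \<Longrightarrow> i' m = i m) \<Longrightarrow> E \<beta> i' a = E \<beta> i a"
  shows "direction_matrix d n k E s 0 $$ (mi_pos d n i, pair_pos k j a)
      = of_bool (i s = j) * (\<Sum>\<beta>\<in>{..<d} - {s}. E \<beta> i a)"
    and "direction_matrix d n k E s 2 $$ (mi_pos d n i, pair_pos k j a)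
      = - of_bool (i s = j) * E s i a"
proof -
  have digit: "mi_digit d n (mi_pos d n i) m = i m" if "m < d" for m
    using assms(1) that by (rule mi_digit_pos)
  have "direction_matrix d n k E s l $$ (mi_pos d n i, pair_pos k j a)
      = of_bool (i s = j) * (\<Sum>\<beta><d. chan_coeff s l \<beta> * E \<beta> i a)" for l
    using assms(1-4) mi_pos_less[of d i n] pair_pos_less[of j "n s" a k] assms(5)[OF digit]
    by (simp add: direction_matrix_def digit)
  then show "direction_matrix d n k E s 0 $$ (mi_pos d n i, pair_pos k j a)
      = of_bool (i s = j) * (\<Sum>\<beta>\<in>{..<d} - {s}. E \<beta> i a)"
    "direction_matrix d n k E s 2 $$ (mi_pos d n i, pair_pos k j a)
      = - of_bool (i s = j) * E s i a"
    using assms(2) by (simp_all add: chan_coeff_def sum.remove)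
qed

lemma cp_env_cong:
  assumes "\<And>m. m < d \<Longrightarrow> j' m = j m"
  shows "cp_env d x u \<theta> s \<beta> j' \<alpha> = cp_env d x u \<theta> s \<beta> j \<alpha>"
  unfolding cp_env_def using assms by (intro prod.cong) auto

lemma cp_direction_entry:
  assumes "\<And>m. m < d \<Longrightarrow> i m < n m" "s < d" "j < n s" "\<alpha> < R"
  shows "cp_direction d n x R u \<theta> s 0 $$ (mi_pos d n i, pair_pos R j \<alpha>)
      = - of_bool (i s = j) *
        (\<Sum>\<beta>\<in>{..<d} - {s}. (deriv ^^ 2) (u \<beta> \<alpha> (\<theta> \<beta>)) (x \<beta> (i \<beta>)) *
           (\<Prod>m\<in>{..<d} - {s, \<beta>}. u m \<alpha> (\<theta> m) (x m (i m))))"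
    and "cp_direction d n x R u \<theta> s 2 $$ (mi_pos d n i, pair_pos R j \<alpha>)
      = - of_bool (i s = j) * (\<Prod>m\<in>{..<d} - {s}. u m \<alpha> (\<theta> m) (x m (i m)))"
proof -
  note entry = direction_matrix_entry[of d i n s j \<alpha> R "cp_env d x u \<theta> s", OF assms cp_env_cong]
  show "cp_direction d n x R u \<theta> s 0 $$ (mi_pos d n i, pair_pos R j \<alpha>)
      = - of_bool (i s = j) *
        (\<Sum>\<beta>\<in>{..<d} - {s}. (deriv ^^ 2) (u \<beta> \<alpha> (\<theta> \<beta>)) (x \<beta> (i \<beta>)) *
           (\<Prod>m\<in>{..<d} - {s, \<beta>}. u m \<alpha> (\<theta> m) (x m (i m))))"
    unfolding cp_direction_def by (simp add: entry cp_env_other sum_negf)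
  show "cp_direction d n x R u \<theta> s 2 $$ (mi_pos d n i, pair_pos R j \<alpha>)
      = - of_bool (i s = j) * (\<Prod>m\<in>{..<d} - {s}. u m \<alpha> (\<theta> m) (x m (i m)))"
    unfolding cp_direction_def by (simp add: entry cp_env_same)
qed

lemma dim_col_append_cols [simp]: "dim_col (append_cols A B) = dim_col A + dim_col B"
  by (simp add: append_cols_def)

lemma dim_row_append_rows [simp]: "dim_row (A @\<^sub>r B) = dim_row A + dim_row B"
  by (simp add: append_rows_def)

section \<open>The tensor train format\<close>

lemma mat_prod_empty [simp]: "b \<le> a \<Longrightarrow> mat_prod q F a b = 1\<^sub>m q"
  by (simp add: mat_prod_def)

lemma mat_prod_rec: "a < b \<Longrightarrow> mat_prod q F a b = F a * mat_prod q F (Suc a) b"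
  by (simp add: mat_prod_def upt_conv_Cons)

lemma mat_prod_cong:
  assumes "\<And>m. a \<le> m \<Longrightarrow> m < b \<Longrightarrow> F m = F' m"
  shows "mat_prod q F a b = mat_prod q F' a b"
  unfolding mat_prod_def using assms by (intro foldr_cong) auto

lemma mat_prod_carrier:
  assumes "a \<le> b" "\<And>m. a \<le> m \<Longrightarrow> m < b \<Longrightarrow> F m \<in> carrier_mat (r m) (r (Suc m))"
  shows "mat_prod (r b) F a b \<in> carrier_mat (r a) (r b)"
  using assms
proof (induction rule: inc_induct)
  case (step k)
  then show ?case
    by (simp add: mat_prod_rec) (meson Suc_leD le_refl mult_carrier_mat)
qed simp

lemma mat_prod_append:
  assumes "a \<le> c" "c \<le> b" "\<And>m. a \<le> m \<Longrightarrow> m < b \<Longrightarrow> F m \<in> carrier_mat (r m) (r (Suc m))"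
  shows "mat_prod (r b) F a b = mat_prod (r c) F a c * mat_prod (r b) F c b"
  using assms(1,3)
proof (induction rule: inc_induct)
  case base
  then have "mat_prod (r b) F c b \<in> carrier_mat (r c) (r b)"
    using assms(2) by (intro mat_prod_carrier) auto
  then show ?case by simp
next
  case (step k)
  have F: "F k \<in> carrier_mat (r k) (r (Suc k))"
    using step assms(2) by auto
  have 1: "mat_prod (r c) F (Suc k) c \<in> carrier_mat (r (Suc k)) (r c)"
    using step assms(2) by (intro mat_prod_carrier) auto
  have 2: "mat_prod (r b) F c b \<in> carrier_mat (r c) (r b)"
    using step assms(2) by (intro mat_prod_carrier) auto
  have "mat_prod (r b) F k b = F k * (mat_prod (r c) F (Suc k) c * mat_prod (r b) F c b)"
    using step assms(2) by (simp add: mat_prod_rec)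
  also have "\<dots> = mat_prod (r c) F k c * mat_prod (r b) F c b"
    using step assoc_mult_mat[OF F 1 2] by (simp add: mat_prod_rec)
  finally show ?case .
qed

text \<open>Multilinearity made explicit: an entry of the product is a linear combination of the
  entries of core \<beta>, whose coefficients are built from the partial products on either side and
  do not change with that core.\<close>

lemma mat_prod_entry_split:
  assumes "a \<le> \<beta>" "\<beta> < b" "\<And>m. a \<le> m \<Longrightarrow> m < b \<Longrightarrow> F m \<in> carrier_mat (r m) (r (Suc m))"
    and "i < r a" "j < r b"
  shows "mat_prod (r b) F a b $$ (i, j)
    = (\<Sum>e\<in>{..<r \<beta>} \<times> {..<r (Suc \<beta>)}.
        (mat_prod (r \<beta>) F a \<beta> $$ (i, fst e) * mat_prod (r b) F (Suc \<beta>) b $$ (snd e, j)) * F \<beta> $$ e)"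
proof -
  define L where "L = mat_prod (r \<beta>) F a \<beta>"
  define T where "T = mat_prod (r b) F (Suc \<beta>) b"
  have L: "L \<in> carrier_mat (r a) (r \<beta>)" and T: "T \<in> carrier_mat (r (Suc \<beta>)) (r b)"
    and F: "F \<beta> \<in> carrier_mat (r \<beta>) (r (Suc \<beta>))"
    unfolding L_def T_def using assms by (auto intro!: mat_prod_carrier)
  have "mat_prod (r b) F a b = L * (F \<beta> * T)"
    unfolding L_def T_def using mat_prod_append[of a \<beta> b F r] assms by (simp add: mat_prod_rec)
  then have "mat_prod (r b) F a b $$ (i, j)
      = (\<Sum>k<r \<beta>. L $$ (i, k) * (\<Sum>l<r (Suc \<beta>). F \<beta> $$ (k, l) * T $$ (l, j)))"
    using L T F assms(4,5) by (simp add: scalar_prod_def lessThan_atLeast0)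
  also have "\<dots> = (\<Sum>k<r \<beta>. \<Sum>l<r (Suc \<beta>). (L $$ (i, k) * T $$ (l, j)) * F \<beta> $$ (k, l))"
    by (simp add: sum_distrib_left mult_ac)
  also have "\<dots> = (\<Sum>e\<in>{..<r \<beta>} \<times> {..<r (Suc \<beta>)}. (L $$ (i, fst e) * T $$ (snd e, j)) * F \<beta> $$ e)"
    by (simp add: sum.cartesian_product case_prod_beta)
  finally show ?thesis
    unfolding L_def T_def .
qed

text \<open>By \<open>mat_prod_entry_split\<close> the entry is a fixed linear combination of the
  entries of \<open>X y\<close>, so regularity and the second derivative pass through entry by
  entry. The minus sign compensates the one inside \<open>mode_op\<close>.\<close>

lemma mat_prod_slice:
  assumes a: "a \<le> \<beta>" "\<beta> < b"
    and F: "\<And>m. a \<le> m \<Longrightarrow> m < b \<Longrightarrow> F m \<in> carrier_mat (r m) (r (Suc m))"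
    and X: "\<And>y. y \<in> {0..1} \<Longrightarrow> X y \<in> carrier_mat (r \<beta>) (r (Suc \<beta>))"
    and C2: "\<And>k l. k < r \<beta> \<Longrightarrow> l < r (Suc \<beta>) \<Longrightarrow> C2_unit (\<lambda>y. X y $$ (k, l))"
    and ij: "i < r a" "j < r b"
  shows "C2_unit (\<lambda>y. mat_prod (r b) (F(\<beta> := X y)) a b $$ (i, j))"
    and "y \<in> {0<..<1} \<Longrightarrow> (deriv ^^ 2) (\<lambda>y. mat_prod (r b) (F(\<beta> := X y)) a b $$ (i, j)) y
      = - mat_prod (r b) (F(\<beta> := entrywise (mode_op \<beta> \<beta>) X y)) a b $$ (i, j)"
proof -
  define c where "c = (\<lambda>e. mat_prod (r \<beta>) F a \<beta> $$ (i, fst e) * mat_prod (r b) F (Suc \<beta>) b $$ (snd e, j))"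
  have split: "mat_prod (r b) (F(\<beta> := Y)) a b $$ (i, j)
      = (\<Sum>e\<in>{..<r \<beta>} \<times> {..<r (Suc \<beta>)}. c e * Y $$ e)"
    if "Y \<in> carrier_mat (r \<beta>) (r (Suc \<beta>))" for Y
  proof -
    have "mat_prod (r \<beta>) (F(\<beta> := Y)) a \<beta> = mat_prod (r \<beta>) F a \<beta>"
      "mat_prod (r b) (F(\<beta> := Y)) (Suc \<beta>) b = mat_prod (r b) F (Suc \<beta>) b"
      by (auto intro: mat_prod_cong)
    then show ?thesis
      using mat_prod_entry_split[of a \<beta> b "F(\<beta> := Y)" r i j] a F ij that by (auto simp: c_def)
  qed
  have C2': "C2_unit (\<lambda>y. X y $$ e)" if "e \<in> {..<r \<beta>} \<times> {..<r (Suc \<beta>)}" for e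
    using C2 that by auto
  have "C2_unit (\<lambda>y. \<Sum>e\<in>{..<r \<beta>} \<times> {..<r (Suc \<beta>)}. c e * X y $$ e)"
    using C2' by (rule C2_unit_sum_mult)
  then show "C2_unit (\<lambda>y. mat_prod (r b) (F(\<beta> := X y)) a b $$ (i, j))"
    \<comment> \<open>The expansion requires \<open>X y\<close> to have the right size, which is
      known on \<open>{0..1}\<close>.\<close>
    by (rule C2_unit_cong) (use X in \<open>simp add: split\<close>)
  show "(deriv ^^ 2) (\<lambda>y. mat_prod (r b) (F(\<beta> := X y)) a b $$ (i, j)) y
      = - mat_prod (r b) (F(\<beta> := entrywise (mode_op \<beta> \<beta>) X y)) a b $$ (i, j)"
    if y: "y \<in> {0<..<1}"
  proof -
    have Xy: "X y \<in> carrier_mat (r \<beta>) (r (Suc \<beta>))"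
      using X y by auto
    then have "entrywise (mode_op \<beta> \<beta>) X y \<in> carrier_mat (r \<beta>) (r (Suc \<beta>))"
      by (auto simp: entrywise_def)
    then have "mat_prod (r b) (F(\<beta> := entrywise (mode_op \<beta> \<beta>) X y)) a b $$ (i, j)
        = (\<Sum>e\<in>{..<r \<beta>} \<times> {..<r (Suc \<beta>)}. c e * - (deriv ^^ 2) (\<lambda>y. X y $$ e) y)"
      unfolding split[OF \<open>entrywise _ _ _ \<in> _\<close>]
      using Xy by (intro sum.cong) (auto simp: entrywise_def mode_op_def)
    also have "\<dots> = - (deriv ^^ 2) (\<lambda>y. \<Sum>e\<in>{..<r \<beta>} \<times> {..<r (Suc \<beta>)}. c e * X y $$ e) y"
      using C2' y by (subst deriv2_sum_mult) (simp_all add: sum_negf)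
    also have "(deriv ^^ 2) (\<lambda>y. \<Sum>e\<in>{..<r \<beta>} \<times> {..<r (Suc \<beta>)}. c e * X y $$ e) y
        = (deriv ^^ 2) (\<lambda>y. mat_prod (r b) (F(\<beta> := X y)) a b $$ (i, j)) y"
      using y X by (intro higher_deriv_unit_cong) (auto simp: split)
    finally show ?thesis
      by (simp only: minus_minus)
  qed
qed

lemma sum_pair_index:
  fixes p q :: nat
  shows "(\<Sum>e\<in>{..<p} \<times> {..<q}. g e) = (\<Sum>c<p * q. g (c div q, c mod q))"
proof (rule sum.reindex_bij_witness[of _ "\<lambda>c. (c div q, c mod q)" "\<lambda>e. pair_pos q (fst e) (snd e)"])
  fix c assume c: "c \<in> {..<p * q}"
  then have "q > 0"
    by (cases q) auto
  then show "(c div q, c mod q) \<in> {..<p} \<times> {..<q}"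
    using c by (simp add: less_mult_imp_div_less)
qed (auto simp: pair_pos_def pair_pos_less[unfolded pair_pos_def])

section \<open>Tensor train coefficients, environments and the Jacobian factorization\<close>

lemma tt_ansatzD:
  assumes "tt_ansatz d r P G"
  shows "r 0 = 1" "r d = 1"
    and "m < d \<Longrightarrow> th \<in> carrier_vec (P m) \<Longrightarrow> y \<in> {0..1} \<Longrightarrow>
      G m th y \<in> carrier_mat (r m) (r (Suc m))"
    and "m < d \<Longrightarrow> a < r m \<Longrightarrow> b < r (Suc m) \<Longrightarrow> admissible_factor (P m) (\<lambda>th y. G m th y $$ (a, b))"
  using assms unfolding tt_ansatz_def by blast+

text \<open>The environment with the family of cores left abstract. It serves both as the
  coefficient of a core entry at an arbitrary point and, with one core replaced by its image under
  the operator, as an environment at a grid point.\<close>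

definition tt_coeff ::
  "nat \<Rightarrow> (nat \<Rightarrow> nat) \<Rightarrow> nat \<Rightarrow> (nat \<Rightarrow> real mat) \<Rightarrow> nat \<Rightarrow> real" where
  "tt_coeff d r s F c =
     mat_prod (r s) F 0 s $$ (0, c div r (Suc s)) * mat_prod 1 F (Suc s) d $$ (c mod r (Suc s), 0)"

lemma tt_env_eq_tt_coeff:
  "tt_env d x r G \<theta> s \<beta> j = tt_coeff d r s (\<lambda>m. entrywise (mode_op \<beta> m) (G m (\<theta> m)) (x m (j m)))"
  by (rule ext) (simp add: tt_env_def tt_coeff_def Let_def)

lemma tt_coeff_cong:
  assumes "\<And>m. m < d \<Longrightarrow> m \<noteq> s \<Longrightarrow> F m = F' m" "s < d"
  shows "tt_coeff d r s F c = tt_coeff d r s F' c"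
proof -
  have "mat_prod (r s) F 0 s = mat_prod (r s) F' 0 s"
    "mat_prod 1 F (Suc s) d = mat_prod 1 F' (Suc s) d"
    using assms by (auto intro!: mat_prod_cong)
  then show ?thesis
    by (simp add: tt_coeff_def)
qed

lemma entrywise_mode_op_other: "m \<noteq> \<beta> \<Longrightarrow> entrywise (mode_op \<beta> m) F y = F y"
  by (rule eq_matI) (auto simp: entrywise_def mode_op_def)

text \<open>Every \<open>mode_op \<beta> m\<close> with \<open>m\<close> different from \<beta> is
  the identity, so the operator alters one core only. This is the update form in which
  \<open>tt_coeff_slice\<close> delivers second derivatives.\<close>

lemma tt_env_eq_update:
  assumes "s < d"
  shows "tt_env d x r G \<theta> s \<beta> j = tt_coeff d r s ((\<lambda>m. G m (\<theta> m) (x m (j m)))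
      (\<beta> := entrywise (mode_op \<beta> \<beta>) (G \<beta> (\<theta> \<beta>)) (x \<beta> (j \<beta>))))"
  unfolding tt_env_eq_tt_coeff
  using assms by (intro ext tt_coeff_cong) (auto simp: entrywise_mode_op_other)

text \<open>The altered core sits at \<open>s\<close>, which both partial products skip.\<close>

lemma tt_env_same:
  assumes "s < d"
  shows "tt_env d x r G \<theta> s s j = tt_coeff d r s (\<lambda>m. G m (\<theta> m) (x m (j m)))"
  unfolding tt_env_eq_update[OF assms]
  using assms by (intro ext tt_coeff_cong) auto

text \<open>Core \<beta> lies strictly to the left or strictly to the right of \<open>s\<close>.
  Exactly one of the two partial products varies with \<open>y\<close>, the other is a constant
  \<open>k\<close>, and \<open>mat_prod_slice\<close> applies to the former.\<close>

lemma tt_coeff_slice: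
  assumes s: "s < d" and \<beta>: "\<beta> < d" "\<beta> \<noteq> s" and r: "r 0 = 1" "r d = 1"
    and F: "\<And>m. m < d \<Longrightarrow> F m \<in> carrier_mat (r m) (r (Suc m))"
    and X: "\<And>y. y \<in> {0..1} \<Longrightarrow> X y \<in> carrier_mat (r \<beta>) (r (Suc \<beta>))"
    and C2: "\<And>k l. k < r \<beta> \<Longrightarrow> l < r (Suc \<beta>) \<Longrightarrow> C2_unit (\<lambda>y. X y $$ (k, l))"
    and c: "c < r s * r (Suc s)"
  shows "C2_unit (\<lambda>y. tt_coeff d r s (F(\<beta> := X y)) c)"
    and "y \<in> {0<..<1} \<Longrightarrow> (deriv ^^ 2) (\<lambda>y. tt_coeff d r s (F(\<beta> := X y)) c) y
      = - tt_coeff d r s (F(\<beta> := entrywise (mode_op \<beta> \<beta>) X y)) c"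
proof -
  define a where "a = c div r (Suc s)"
  define b where "b = c mod r (Suc s)"
  \<comment> \<open>An index \<open>c\<close> below the product of the ranks excludes rank 0, so
    division and remainder give valid rank indices.\<close>
  have "r (Suc s) > 0"
    using c by (cases "r (Suc s)") auto
  then have a: "a < r s" and b: "b < r (Suc s)"
    using c by (auto simp: a_def b_def less_mult_imp_div_less)
  note slice_L = mat_prod_slice[of 0 \<beta> s F r X 0 a]
  note slice_R = mat_prod_slice[of "Suc s" \<beta> d F r X b 0]
  have L: "mat_prod (r s) (F(\<beta> := Y)) 0 s = mat_prod (r s) F 0 s" if "\<beta> > s" for Y
    using that by (intro mat_prod_cong) auto
  have R: "mat_prod (Suc 0) (F(\<beta> := Y)) (Suc s) d = mat_prod (Suc 0) F (Suc s) d" if "\<beta> < s" for Y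
    using that by (intro mat_prod_cong) auto
  consider "\<beta> < s" | "\<beta> > s"
    using \<beta> by linarith
  then have "C2_unit (\<lambda>y. tt_coeff d r s (F(\<beta> := X y)) c) \<and> (y \<in> {0<..<1} \<longrightarrow>
      (deriv ^^ 2) (\<lambda>y. tt_coeff d r s (F(\<beta> := X y)) c) y
        = - tt_coeff d r s (F(\<beta> := entrywise (mode_op \<beta> \<beta>) X y)) c)"
  proof cases
    case 1
    define k where "k = mat_prod (Suc 0) F (Suc s) d $$ (b, 0)"
    have eq: "tt_coeff d r s (F(\<beta> := Y)) c = k * mat_prod (r s) (F(\<beta> := Y)) 0 s $$ (0, a)" for Y
      using 1 by (simp add: tt_coeff_def R k_def a_def b_def)
    show ?thesis
      unfolding eq using 1 s r a slice_L F X C2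
      by (auto intro!: C2_unit_mult simp: deriv2_mult)
  next
    case 2
    define k where "k = mat_prod (r s) F 0 s $$ (0, a)"
    have eq: "tt_coeff d r s (F(\<beta> := Y)) c = k * mat_prod (r d) (F(\<beta> := Y)) (Suc s) d $$ (b, 0)" for Y
      using 2 r by (simp add: tt_coeff_def L k_def a_def b_def)
    show ?thesis
      unfolding eq using 2 s \<beta> r b slice_R F X C2
      by (auto intro!: C2_unit_mult simp: deriv2_mult)
  qed
  then show "C2_unit (\<lambda>y. tt_coeff d r s (F(\<beta> := X y)) c)"
    "y \<in> {0<..<1} \<Longrightarrow> (deriv ^^ 2) (\<lambda>y. tt_coeff d r s (F(\<beta> := X y)) c) y
      = - tt_coeff d r s (F(\<beta> := entrywise (mode_op \<beta> \<beta>) X y)) c"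
    by auto
qed

text \<open>Splitting the product at core \<open>s\<close> isolates the only core affected by the
  update of the parameters; the pair of rank indices is flattened lexicographically by
  \<open>sum_pair_index\<close>.\<close>

lemma tt_eval_split:
  assumes ansatz: "tt_ansatz d r P G" and s: "s < d"
    and param: "\<And>m. m < d \<Longrightarrow> \<theta> m \<in> carrier_vec (P m)" "th \<in> carrier_vec (P s)"
    and z: "z \<in> open_cube d"
  shows "tt_eval d G (\<theta>(s := th)) z = (\<Sum>c<r s * r (Suc s).
    tt_coeff d r s (\<lambda>m. G m (\<theta> m) (z $ m)) c *
    G s th (z $ s) $$ (c div r (Suc s), c mod r (Suc s)))"
proof -
  note r = tt_ansatzD(1,2)[OF ansatz]
  define F where "F = (\<lambda>m. G m ((\<theta>(s := th)) m) (z $ m))"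
  have F: "F m \<in> carrier_mat (r m) (r (Suc m))" if "m < d" for m
    unfolding F_def using that z param by (intro tt_ansatzD(3)[OF ansatz]) (auto simp: open_cube_def)
  have "tt_eval d G (\<theta>(s := th)) z = mat_prod (r d) F 0 d $$ (0, 0)"
    unfolding tt_eval_def F_def r ..
  also have "\<dots> = (\<Sum>c<r s * r (Suc s). tt_coeff d r s F c * F s $$ (c div r (Suc s), c mod r (Suc s)))"
    using mat_prod_entry_split[of 0 s d F r 0 0] s r F
    by (simp add: sum_pair_index tt_coeff_def)
  also have "tt_coeff d r s F = tt_coeff d r s (\<lambda>m. G m (\<theta> m) (z $ m))"
    using s by (intro ext tt_coeff_cong) (auto simp: F_def)
  finally show ?thesis
    by (simp only: F_def fun_upd_same)
qed

lemma tt_factorization: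
  assumes s: "s < d"
    and grid: "\<And>m j. m < d \<Longrightarrow> j < n m \<Longrightarrow> x m j \<in> {0<..<1}"
    and param: "\<And>m. m < d \<Longrightarrow> \<theta> m \<in> carrier_vec (P m)"
    and ansatz: "tt_ansatz d r P G"
  shows "jacobian_block d n x P (tt_eval d G) \<theta> s = tt_Psi d n x r G \<theta> s * tt_C n x P r G \<theta> s"
  unfolding tt_Psi_def tt_C_def tt_direction_def tt_sensitivity_def
proof (rule jacobian_block_factorization
    [where E = "\<lambda>c z. tt_coeff d r s (\<lambda>m. G m (\<theta> m) (z $ m)) c" and x = x and P = P and \<theta> = \<theta>,
      OF s grid param[OF s]])
  note r = tt_ansatzD(1,2)[OF ansatz]
  have G: "G m (\<theta> m) y \<in> carrier_mat (r m) (r (Suc m))" if "m < d" "y \<in> {0..1}" for m y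
    using tt_ansatzD(3)[OF ansatz] param that by blast
  have C2: "C2_unit (\<lambda>y. G m (\<theta> m) y $$ (a, b))" if "m < d" "a < r m" "b < r (Suc m)" for m a b
    using tt_ansatzD(4)[OF ansatz that] param that unfolding admissible_factor_def by blast
  \<comment> \<open>Moving coordinate \<beta> exchanges core \<beta> alone, which brings the
    coefficient into the form of \<open>tt_coeff_slice\<close>.\<close>
  have slice: "tt_coeff d r s (\<lambda>m. G m (\<theta> m) (vec_upd z \<beta> y $ m)) c
      = tt_coeff d r s ((\<lambda>m. G m (\<theta> m) (z $ m))(\<beta> := G \<beta> (\<theta> \<beta>) y)) c"
    if "dim_vec z = d" for c z \<beta> y
    using that s by (intro tt_coeff_cong) auto
  show "admissible_factor (P s) (\<lambda>th y. G s th y $$ (c div r (Suc s), c mod r (Suc s)))"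
    if "c < r s * r (Suc s)" for c
  proof -
    have "r (Suc s) > 0"
      using that by (cases "r (Suc s)") auto
    then show ?thesis
      using that s by (intro tt_ansatzD(4)[OF ansatz]) (auto simp: less_mult_imp_div_less)
  qed
  show "tt_eval d G (\<theta>(s := th)) z = (\<Sum>c<r s * r (Suc s).
      tt_coeff d r s (\<lambda>m. G m (\<theta> m) (z $ m)) c *
      G s th (z $ s) $$ (c div r (Suc s), c mod r (Suc s)))"
    if "th \<in> carrier_vec (P s)" "z \<in> open_cube d" for th z
    using ansatz s param that by (rule tt_eval_split)
  show "tt_coeff d r s (\<lambda>m. G m (\<theta> m) (vec_upd z s y $ m)) c
      = tt_coeff d r s (\<lambda>m. G m (\<theta> m) (z $ m)) c" if "z \<in> open_cube d" for c z y
    using that s by (intro tt_coeff_cong) (auto simp: open_cube_def)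
  show "C2_unit (\<lambda>y. tt_coeff d r s (\<lambda>m. G m (\<theta> m) (vec_upd z \<beta> y $ m)) c)"
    if "c < r s * r (Suc s)" "z \<in> open_cube d" "\<beta> < d" "\<beta> \<noteq> s" for c z \<beta>
  proof -
    have dim: "dim_vec z = d"
      using that by (simp add: open_cube_def)
    show ?thesis
      unfolding slice[OF dim]
    proof (rule tt_coeff_slice(1)[OF s that(3,4) r _ G[OF that(3)] C2[OF that(3)] that(1)])
      show "G m (\<theta> m) (z $ m) \<in> carrier_mat (r m) (r (Suc m))" if "m < d" for m
        using that \<open>z \<in> open_cube d\<close> by (intro G) (auto simp: open_cube_def less_imp_le)
    qed
  qed
  show "tt_env d x r G \<theta> s s j c = tt_coeff d r s (\<lambda>m. G m (\<theta> m) (grid_point d x j $ m)) c" for c j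
    unfolding tt_env_same[OF s] using s by (intro tt_coeff_cong) (auto simp: grid_point_def)
  show "tt_env d x r G \<theta> s \<beta> j c = - (deriv ^^ 2) (\<lambda>y.
      tt_coeff d r s (\<lambda>m. G m (\<theta> m) (vec_upd (grid_point d x j) \<beta> y $ m)) c) (x \<beta> (j \<beta>))"
    if c: "c < r s * r (Suc s)" and j: "\<And>m. m < d \<Longrightarrow> j m < n m" and \<beta>: "\<beta> < d" "\<beta> \<noteq> s" for c j \<beta>
  proof -
    have dim: "dim_vec (grid_point d x j) = d"
      by (simp add: grid_point_def)
    have x: "x m (j m) \<in> {0<..<1}" if "m < d" for m
      using grid j that by blast
    have "(deriv ^^ 2) (\<lambda>y.
        tt_coeff d r s (\<lambda>m. G m (\<theta> m) (vec_upd (grid_point d x j) \<beta> y $ m)) c) (x \<beta> (j \<beta>))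
      = - tt_coeff d r s ((\<lambda>m. G m (\<theta> m) (grid_point d x j $ m))
          (\<beta> := entrywise (mode_op \<beta> \<beta>) (G \<beta> (\<theta> \<beta>)) (x \<beta> (j \<beta>)))) c"
      unfolding slice[OF dim]
    proof (rule tt_coeff_slice(2)[OF s \<beta> r _ G[OF \<beta>(1)] C2[OF \<beta>(1)] c x[OF \<beta>(1)]])
      show "G m (\<theta> m) (grid_point d x j $ m) \<in> carrier_mat (r m) (r (Suc m))" if "m < d" for m
        using that x[OF that] by (intro G) (auto simp: grid_point_def)
    qed
    also have "tt_coeff d r s ((\<lambda>m. G m (\<theta> m) (grid_point d x j $ m))
          (\<beta> := entrywise (mode_op \<beta> \<beta>) (G \<beta> (\<theta> \<beta>)) (x \<beta> (j \<beta>)))) c = tt_env d x r G \<theta> s \<beta> j c"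
      unfolding tt_env_eq_update[OF s] using s by (intro tt_coeff_cong) (auto simp: grid_point_def)
    finally show ?thesis by simp
  qed
qed

text \<open>Leibniz rule for products of \<open>A m\<close> + \<epsilon> \<open>D m\<close> with
  \<epsilon>^2 = 0, proved by peeling off the leftmost factor. The upper right block is a sum of
  entries rather than of matrices so that the empty sum is a zero matrix of definite size.\<close>

lemma mat_prod_block:
  assumes "a \<le> b"
    and "\<And>m. a \<le> m \<Longrightarrow> m < b \<Longrightarrow> A m \<in> carrier_mat (r m) (r (Suc m))"
    and "\<And>m. a \<le> m \<Longrightarrow> m < b \<Longrightarrow> D m \<in> carrier_mat (r m) (r (Suc m))"
    and "\<And>m. a \<le> m \<Longrightarrow> m < b \<Longrightarrow>
      B m = four_block_mat (A m) (D m) (0\<^sub>m (r m) (r (Suc m))) (A m)"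
  shows "mat_prod (2 * r b) B a b = four_block_mat (mat_prod (r b) A a b)
    (mat (r a) (r b) (\<lambda>e. \<Sum>\<beta>\<in>{a..<b}. mat_prod (r b) (A(\<beta> := D \<beta>)) a b $$ e))
    (0\<^sub>m (r a) (r b)) (mat_prod (r b) A a b)"
  using assms
proof (induction rule: inc_induct)
  case base
  show ?case
    by (rule eq_matI) auto
next
  case (step a)
  define S where "S = mat (r (Suc a)) (r b)
    (\<lambda>e. \<Sum>\<beta>\<in>{Suc a..<b}. mat_prod (r b) (A(\<beta> := D \<beta>)) (Suc a) b $$ e)"
  define M where "M = mat_prod (r b) A (Suc a) b"
  have A: "A a \<in> carrier_mat (r a) (r (Suc a))" and D: "D a \<in> carrier_mat (r a) (r (Suc a))"
    using step by auto
  have M: "M \<in> carrier_mat (r (Suc a)) (r b)"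
    unfolding M_def using step by (intro mat_prod_carrier) auto
  have S: "S \<in> carrier_mat (r (Suc a)) (r b)"
    by (simp add: S_def)
  have M': "mat_prod (r b) (A(\<beta> := D \<beta>)) (Suc a) b \<in> carrier_mat (r (Suc a)) (r b)"
    if "\<beta> \<in> {Suc a..<b}" for \<beta>
    using step that by (intro mat_prod_carrier) auto
  have IH: "mat_prod (2 * r b) B (Suc a) b = four_block_mat M S (0\<^sub>m (r (Suc a)) (r b)) M"
    unfolding M_def S_def by (rule step.IH) (use step.prems in auto)
  have "mat_prod (2 * r b) B a b = B a * mat_prod (2 * r b) B (Suc a) b"
    using step by (simp add: mat_prod_rec)
  also have "\<dots> = four_block_mat (A a * M) (A a * S + D a * M) (0\<^sub>m (r a) (r b)) (A a * M)"
    using step.prems(3)[of a] step.hyps A D M S unfolding IH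
    by (simp add: mult_four_block_mat[OF A D zero_carrier_mat A M S zero_carrier_mat M])
  also have "A a * M = mat_prod (r b) A a b"
    unfolding M_def using step by (simp add: mat_prod_rec)
  \<comment> \<open>The summand with \<beta> = \<open>a\<close> is \<open>D a * M\<close>; in all
    others the dual part lies further right, and \<open>A a\<close> is the common left
    factor.\<close>
  also have "A a * S + D a * M
      = mat (r a) (r b) (\<lambda>e. \<Sum>\<beta>\<in>{a..<b}. mat_prod (r b) (A(\<beta> := D \<beta>)) a b $$ e)"
  proof (rule eq_matI)
    fix i j
    assume "i < dim_row (mat (r a) (r b) (\<lambda>e. \<Sum>\<beta>\<in>{a..<b}. mat_prod (r b) (A(\<beta> := D \<beta>)) a b $$ e))"
      "j < dim_col (mat (r a) (r b) (\<lambda>e. \<Sum>\<beta>\<in>{a..<b}. mat_prod (r b) (A(\<beta> := D \<beta>)) a b $$ e))"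
    then have ij: "i < r a" "j < r b" by auto
    have "mat_prod (r b) (A(a := D a)) (Suc a) b = M"
      unfolding M_def by (rule mat_prod_cong) auto
    then have first: "mat_prod (r b) (A(a := D a)) a b = D a * M"
      using step by (simp add: mat_prod_rec del: fun_upd_apply) simp
    have later: "mat_prod (r b) (A(\<beta> := D \<beta>)) a b $$ (i, j)
        = (\<Sum>k<r (Suc a). A a $$ (i, k) * mat_prod (r b) (A(\<beta> := D \<beta>)) (Suc a) b $$ (k, j))"
      if "\<beta> \<in> {Suc a..<b}" for \<beta>
    proof -
      have "mat_prod (r b) (A(\<beta> := D \<beta>)) a b = A a * mat_prod (r b) (A(\<beta> := D \<beta>)) (Suc a) b"
        using that step by (subst mat_prod_rec) auto
      then show ?thesis
        using A M'[OF that] ij by (simp add: scalar_prod_def lessThan_atLeast0 del: fun_upd_apply)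
    qed
    have "(A a * S) $$ (i, j) = (\<Sum>k<r (Suc a). A a $$ (i, k) *
        (\<Sum>\<beta>\<in>{Suc a..<b}. mat_prod (r b) (A(\<beta> := D \<beta>)) (Suc a) b $$ (k, j)))"
      using A ij by (simp add: S_def scalar_prod_def lessThan_atLeast0 del: fun_upd_apply)
    also have "\<dots> = (\<Sum>\<beta>\<in>{Suc a..<b}. mat_prod (r b) (A(\<beta> := D \<beta>)) a b $$ (i, j))"
      unfolding sum_distrib_left by (subst sum.swap) (simp add: later del: fun_upd_apply)
    finally have "(A a * S + D a * M) $$ (i, j)
        = (\<Sum>\<beta>\<in>{Suc a..<b}. mat_prod (r b) (A(\<beta> := D \<beta>)) a b $$ (i, j)) + (D a * M) $$ (i, j)"
      using A D M S ij by simp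
    also have "\<dots> = (\<Sum>\<beta>\<in>{a..<b}. mat_prod (r b) (A(\<beta> := D \<beta>)) a b $$ (i, j))"
      using step.hyps first by (simp add: sum.atLeast_Suc_lessThan del: fun_upd_apply)
    finally show "(A a * S + D a * M) $$ (i, j) =
        mat (r a) (r b) (\<lambda>e. \<Sum>\<beta>\<in>{a..<b}. mat_prod (r b) (A(\<beta> := D \<beta>)) a b $$ e) $$ (i, j)"
      using ij by simp
  qed (use A D M S in auto)
  finally show ?case .
qed

text \<open>The left boundary vector selects row 0. As \<open>r 0 = 1\<close>, this row of the
  transfer product holds the plain product followed by the summed differentiated products.\<close>

lemma row_unit_mult:
  assumes "M \<in> carrier_mat 2 q"
  shows "mat_of_rows_list 2 [[1, 0]] * M \<in> carrier_mat 1 q"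
    and "k < q \<Longrightarrow> (mat_of_rows_list 2 [[1, 0]] * M) $$ (0, k) = (M $$ (0, k) :: real)"
  using assms by (auto simp: mat_of_rows_list_def scalar_prod_def numeral_2_eq_2)

text \<open>The right boundary vector selects column 1. As \<open>r d = 1\<close>, this column holds
  the summed differentiated products above the plain product.\<close>

lemma mult_col_unit:
  assumes "M \<in> carrier_mat q 2"
  shows "M * mat_of_cols_list 2 [[0, 1]] \<in> carrier_mat q 1"
    and "k < q \<Longrightarrow> (M * mat_of_cols_list 2 [[0, 1]]) $$ (k, 0) = (M $$ (k, 1) :: real)"
proof -
  have col: "mat_of_cols_list 2 [[0, 1]] = mat 2 1 (\<lambda>e. of_bool (fst e = 1) :: real)"
    unfolding mat_of_cols_list_def by (rule eq_matI) (auto simp: less_2_cases_iff)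
  show "M * mat_of_cols_list 2 [[0, 1]] \<in> carrier_mat q 1"
    using assms by (simp add: col)
  show "(M * mat_of_cols_list 2 [[0, 1]]) $$ (k, 0) = (M $$ (k, 1) :: real)" if "k < q"
    using assms that unfolding col by (simp add: scalar_prod_def numeral_2_eq_2)
qed

lemma triple_product_entry:
  assumes "Q \<in> carrier_mat 1 m" "M \<in> carrier_mat m n" "Q' \<in> carrier_mat n 1"
  shows "(Q * M * Q') $$ (0, 0) = (\<Sum>l<n. (\<Sum>k<m. Q $$ (0, k) * M $$ (k, l)) * Q' $$ (l, 0))"
  using assms by (simp add: scalar_prod_def lessThan_atLeast0 del: assoc_mult_mat)

text \<open>The bilinear form of the matrix unit at position (\<open>a\<close>,
  \<open>b\<close>).\<close>

lemma sum_unit_entry: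
  fixes f g :: "nat \<Rightarrow> real"
  assumes "a < m" "b < n"
  shows "(\<Sum>l<n. (\<Sum>k<m. f k * of_bool (k = a \<and> l = b)) * g l) = f a * g b"
proof -
  have "(\<Sum>k<m. f k * of_bool (k = a \<and> l = b)) * g l = (if l = b then f a * g b else 0)" for l
  proof (cases "l = b")
    case True
    have "(\<Sum>k<m. f k * of_bool (k = a \<and> l = b)) = (\<Sum>k<m. if k = a then f k else 0)"
      using True by (intro sum.cong) simp_all
    then show ?thesis
      using assms(1) True by simp
  qed simp
  then have "(\<Sum>l<n. (\<Sum>k<m. f k * of_bool (k = a \<and> l = b)) * g l)
      = (\<Sum>l<n. if l = b then f a * g b else 0)"
    by (rule sum.cong[OF refl])
  also have "\<dots> = f a * g b"
    using assms(2) by simp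
  finally show ?thesis .
qed

section \<open>Channel matrices between the two boundary vectors\<close>

lemma M_mat_carrier: "M_mat p q a b \<in> carrier_mat p q"
  by (rule carrier_matI) (simp_all add: M_mat_def)

lemma M_mat_entry:
  assumes "k < p" "l < q"
  shows "M_mat p q a b $$ (k, l) = of_bool (k = a \<and> l = b)"
  using assms
  by (simp add: M_mat_def scalar_prod_def mat_of_cols_index mat_of_row_def unit_vec_def)

lemma P_mat_carrier: "P_mat p q l a b \<in> carrier_mat (2 * p) (2 * q)"
  using M_mat_carrier[of p q a b] by (intro carrier_matI) (simp_all add: P_mat_def)

text \<open>Block positions become offsets: the lower half of the rows starts at \<open>p\<close>,
  the right half of the columns at \<open>q\<close>. Channel 0 is a sum of two matrix units, channel
  2 a negated one.\<close>

lemma P_mat_entry: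
  assumes "k < 2 * p" "l < 2 * q" "a < p" "b < q"
  shows "P_mat p q 0 a b $$ (k, l) = of_bool (k = a \<and> l = b) + of_bool (k = p + a \<and> l = q + b)"
    and "P_mat p q 2 a b $$ (k, l) = - of_bool (k = a \<and> l = q + b)"
  using assms carrier_matD[OF M_mat_carrier[of p q a b]]
  by (cases "k < p"; cases "l < q"; simp add: P_mat_def M_mat_entry; linarith?)+

text \<open>Channel 0 pairs plain left with differentiated right and differentiated left with plain
  right, so the operator acts once, on one side of \<open>s\<close>. Channel 2 pairs the two plain
  halves, its minus sign standing for the operator acting at \<open>s\<close> itself.\<close>

lemma P_mat_sandwich:
  assumes "Q \<in> carrier_mat 1 (2 * p)" "Q' \<in> carrier_mat (2 * q) 1" "a < p" "b < q"
  shows "(Q * P_mat p q 0 a b * Q') $$ (0, 0)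
      = Q $$ (0, a) * Q' $$ (b, 0) + Q $$ (0, p + a) * Q' $$ (q + b, 0)"
    and "(Q * P_mat p q 2 a b * Q') $$ (0, 0) = - (Q $$ (0, a) * Q' $$ (q + b, 0))"
proof -
  define f where "f = (\<lambda>k. Q $$ (0, k))"
  define g where "g = (\<lambda>l. Q' $$ (l, 0))"
  have "(Q * P_mat p q 0 a b * Q') $$ (0, 0)
      = (\<Sum>l<2 * q. (\<Sum>k<2 * p. f k * of_bool (k = a \<and> l = b)) * g l)
      + (\<Sum>l<2 * q. (\<Sum>k<2 * p. f k * of_bool (k = p + a \<and> l = q + b)) * g l)"
    unfolding triple_product_entry[OF assms(1) P_mat_carrier assms(2)]
      sum.distrib[symmetric] distrib_left[symmetric] distrib_right[symmetric]
    by (intro sum.cong refl arg_cong2[where f = "(*)"])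
      (use assms(3,4) in \<open>auto simp only: P_mat_entry f_def g_def lessThan_iff\<close>)
  also have "\<dots> = f a * g b + f (p + a) * g (q + b)"
    using assms(3,4) by (intro arg_cong2[where f = "(+)"] sum_unit_entry) linarith+
  finally show "(Q * P_mat p q 0 a b * Q') $$ (0, 0)
      = Q $$ (0, a) * Q' $$ (b, 0) + Q $$ (0, p + a) * Q' $$ (q + b, 0)"
    by (simp only: f_def g_def)
  have "(Q * P_mat p q 2 a b * Q') $$ (0, 0)
      = (\<Sum>l<2 * q. (\<Sum>k<2 * p. - f k * of_bool (k = a \<and> l = q + b)) * g l)"
    unfolding triple_product_entry[OF assms(1) P_mat_carrier assms(2)]
    by (rule sum.cong[OF refl], rule arg_cong2[where f = "(*)", OF sum.cong[OF refl]])
      (use assms(3,4) in \<open>auto simp only: P_mat_entry f_def g_def lessThan_iff mult_minus_left mult_minus_right\<close>)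
  also have "\<dots> = - f a * g (q + b)"
    using assms(3,4) by (intro sum_unit_entry) linarith+
  finally show "(Q * P_mat p q 2 a b * Q') $$ (0, 0) = - (Q $$ (0, a) * Q' $$ (q + b, 0))"
    by (simp only: f_def g_def mult_minus_left)
qed

text \<open>The corner block is the core with the operator applied entrywise, so the transfer matrix
  has the shape required by \<open>mat_prod_block\<close>.\<close>

lemma B_mat_eq:
  assumes "G m (\<theta> m) y \<in> carrier_mat p q"
  shows "B_mat G \<theta> m y = four_block_mat (G m (\<theta> m) y) (entrywise (mode_op m m) (G m (\<theta> m)) y)
    (0\<^sub>m p q) (G m (\<theta> m) y)"
proof -
  have "- entrywise (deriv ^^ 2) (G m (\<theta> m)) y = entrywise (mode_op m m) (G m (\<theta> m)) y"
    by (rule eq_matI) (auto simp: entrywise_def mode_op_def)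
  then show ?thesis
    using assms by (simp add: B_mat_def Let_def)
qed

lemma tt_env_cong:
  assumes "\<And>m. m < d \<Longrightarrow> j' m = j m" "s < d"
  shows "tt_env d x r G \<theta> s \<beta> j' c = tt_env d x r G \<theta> s \<beta> j c"
  unfolding tt_env_eq_tt_coeff using assms by (intro tt_coeff_cong) auto

lemma tt_direction_transfer:
  fixes i :: "nat \<Rightarrow> nat"
  assumes ansatz: "tt_ansatz d r P G" and s: "s < d"
    and grid: "\<And>m j. m < d \<Longrightarrow> j < n m \<Longrightarrow> x m j \<in> {0<..<1}"
    and param: "\<And>m. m < d \<Longrightarrow> \<theta> m \<in> carrier_vec (P m)"
    and i: "\<And>m. m < d \<Longrightarrow> i m < n m"
  defines "Q \<equiv> Q_before r G \<theta> s (\<lambda>m. x m (i m))" and "Q' \<equiv> Q_after d G \<theta> s (\<lambda>m. x m (i m))"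
  shows "Q \<in> carrier_mat 1 (2 * r s)" "Q' \<in> carrier_mat (2 * r (Suc s)) 1"
    and "l \<in> {0, 2} \<Longrightarrow> j < n s \<Longrightarrow> a < r s \<Longrightarrow> b < r (Suc s) \<Longrightarrow>
      tt_direction d n x r G \<theta> s l
          $$ (mi_pos d n i, pair_pos (r s * r (Suc s)) j (pair_pos (r (Suc s)) a b))
        = of_bool (i s = j) * (Q * P_mat (r s) (r (Suc s)) l a b * Q') $$ (0, 0)"
proof -
  note r = tt_ansatzD(1,2)[OF ansatz]
  define A where "A = (\<lambda>m. G m (\<theta> m) (x m (i m)))"
  define D where "D = (\<lambda>m. entrywise (mode_op m m) (G m (\<theta> m)) (x m (i m)))"
  have A: "A m \<in> carrier_mat (r m) (r (Suc m))" if "m < d" for m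
    unfolding A_def using grid[OF that i[OF that]] that param
    by (intro tt_ansatzD(3)[OF ansatz]) auto
  have D: "D m \<in> carrier_mat (r m) (r (Suc m))" if "m < d" for m
    using A[OF that] by (auto simp: A_def D_def entrywise_def)
  have B: "B_mat G \<theta> m (x m (i m)) = four_block_mat (A m) (D m) (0\<^sub>m (r m) (r (Suc m))) (A m)"
    if "m < d" for m
    using B_mat_eq[of G m \<theta> "x m (i m)", OF A[OF that, unfolded A_def]] by (simp add: A_def D_def)
  define L where "L = mat_prod (r s) A 0 s"
  define R where "R = mat_prod (r d) A (Suc s) d"
  \<comment> \<open>\<open>L' \<beta>\<close> and \<open>R' \<beta>\<close> are the partial products
    with core \<beta> replaced by its image under the operator; if \<beta> lies on the other side of
    \<open>s\<close>, nothing changes (\<open>R'_eq\<close>, \<open>L'_eq\<close>).\<close>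
  define L' where "L' = (\<lambda>\<beta>. mat_prod (r s) (A(\<beta> := D \<beta>)) 0 s)"
  define R' where "R' = (\<lambda>\<beta>. mat_prod (r d) (A(\<beta> := D \<beta>)) (Suc s) d)"
  have L: "L \<in> carrier_mat 1 (r s)" and R: "R \<in> carrier_mat (r (Suc s)) 1"
    unfolding L_def R_def using mat_prod_carrier[of 0 s A r] mat_prod_carrier[of "Suc s" d A r] A s r
    by auto
  have "mat_prod (2 * r s) (\<lambda>m. B_mat G \<theta> m (x m (i m))) 0 s
      = four_block_mat L (mat 1 (r s) (\<lambda>e. \<Sum>\<beta>\<in>{0..<s}. L' \<beta> $$ e)) (0\<^sub>m 1 (r s)) L"
    unfolding L_def L'_def using s A D B mat_prod_block[of 0 s A r D] r by simp
  moreover have "\<dots> \<in> carrier_mat 2 (2 * r s)"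
    using L by auto
  ultimately have Q: "Q \<in> carrier_mat 1 (2 * r s)"
    and Q_entry: "\<And>k. k < 2 * r s \<Longrightarrow> Q $$ (0, k)
      = four_block_mat L (mat 1 (r s) (\<lambda>e. \<Sum>\<beta>\<in>{0..<s}. L' \<beta> $$ e)) (0\<^sub>m 1 (r s)) L $$ (0, k)"
    unfolding Q_def Q_before_def by (simp_all only: row_unit_mult)
  have "mat_prod 2 (\<lambda>m. B_mat G \<theta> m (x m (i m))) (Suc s) d
      = four_block_mat R (mat (r (Suc s)) 1 (\<lambda>e. \<Sum>\<beta>\<in>{Suc s..<d}. R' \<beta> $$ e)) (0\<^sub>m (r (Suc s)) 1) R"
    unfolding R_def R'_def using s A D B mat_prod_block[of "Suc s" d A r D] r by simp
  moreover have "\<dots> \<in> carrier_mat (2 * r (Suc s)) 2"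
    using R by auto
  ultimately have Q': "Q' \<in> carrier_mat (2 * r (Suc s)) 1"
    and Q'_entry: "\<And>k. k < 2 * r (Suc s) \<Longrightarrow> Q' $$ (k, 0)
      = four_block_mat R (mat (r (Suc s)) 1 (\<lambda>e. \<Sum>\<beta>\<in>{Suc s..<d}. R' \<beta> $$ e)) (0\<^sub>m (r (Suc s)) 1) R
          $$ (k, 1)"
    unfolding Q'_def Q_after_def by (simp_all only: mult_col_unit)
  show "Q \<in> carrier_mat 1 (2 * r s)" "Q' \<in> carrier_mat (2 * r (Suc s)) 1"
    by (rule Q, rule Q')
  show "tt_direction d n x r G \<theta> s l
          $$ (mi_pos d n i, pair_pos (r s * r (Suc s)) j (pair_pos (r (Suc s)) a b))
        = of_bool (i s = j) * (Q * P_mat (r s) (r (Suc s)) l a b * Q') $$ (0, 0)"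
    if l: "l \<in> {0, 2}" and j: "j < n s" and a: "a < r s" and b: "b < r (Suc s)"
  proof -
    define c where "c = pair_pos (r (Suc s)) a b"
    have c: "c < r s * r (Suc s)" "c div r (Suc s) = a" "c mod r (Suc s) = b"
      unfolding c_def using a b by (simp_all add: pair_pos_less)
    have Q_left: "Q $$ (0, a) = L $$ (0, a)"
      and Q_right: "Q $$ (0, r s + a) = (\<Sum>\<beta><s. L' \<beta> $$ (0, a))"
      using a L by (simp_all add: Q_entry lessThan_atLeast0)
    have Q'_top: "Q' $$ (b, 0) = (\<Sum>\<beta>\<in>{Suc s..<d}. R' \<beta> $$ (b, 0))"
      and Q'_bottom: "Q' $$ (r (Suc s) + b, 0) = R $$ (b, 0)"
      using b R by (simp_all add: Q'_entry)
    have env_s: "tt_env d x r G \<theta> s s i c = L $$ (0, a) * R $$ (b, 0)"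
      using s r c by (simp add: tt_env_same tt_coeff_def L_def R_def A_def)
    have env: "tt_env d x r G \<theta> s \<beta> i c = L' \<beta> $$ (0, a) * R' \<beta> $$ (b, 0)" for \<beta>
      using s r c
      by (simp add: tt_env_eq_update tt_coeff_def L'_def R'_def A_def D_def del: fun_upd_apply)
    have R'_eq: "R' \<beta> = R" if "\<beta> < s" for \<beta>
      unfolding R'_def R_def using that by (intro mat_prod_cong) auto
    have L'_eq: "L' \<beta> = L" if "\<beta> \<in> {Suc s..<d}" for \<beta>
      unfolding L'_def L_def using that by (intro mat_prod_cong) auto
    \<comment> \<open>The modes left of \<open>s\<close> supply the differentiated left factor,
      those right of it the differentiated right factor: the two terms of
      \<open>P_mat_sandwich\<close> for channel 0.\<close>
    have "{..<d} - {s} = {..<s} \<union> {Suc s..<d}"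
      using s by auto
    then have "(\<Sum>\<beta>\<in>{..<d} - {s}. tt_env d x r G \<theta> s \<beta> i c)
        = (\<Sum>\<beta><s. tt_env d x r G \<theta> s \<beta> i c) + (\<Sum>\<beta>\<in>{Suc s..<d}. tt_env d x r G \<theta> s \<beta> i c)"
      by (simp add: sum.union_disjoint disjoint_iff)
    also have "\<dots> = L $$ (0, a) * Q' $$ (b, 0) + Q $$ (0, r s + a) * R $$ (b, 0)"
      by (simp add: env R'_eq L'_eq Q'_top Q_right sum_distrib_left sum_distrib_right)
    finally have env_sum: "(\<Sum>\<beta>\<in>{..<d} - {s}. tt_env d x r G \<theta> s \<beta> i c)
        = (Q * P_mat (r s) (r (Suc s)) 0 a b * Q') $$ (0, 0)"
      by (simp add: P_mat_sandwich[OF Q Q' a b] Q_left Q'_bottom)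
    have entry: "tt_direction d n x r G \<theta> s 0 $$ (mi_pos d n i, pair_pos (r s * r (Suc s)) j c)
        = of_bool (i s = j) * (\<Sum>\<beta>\<in>{..<d} - {s}. tt_env d x r G \<theta> s \<beta> i c)"
      "tt_direction d n x r G \<theta> s 2 $$ (mi_pos d n i, pair_pos (r s * r (Suc s)) j c)
        = - of_bool (i s = j) * tt_env d x r G \<theta> s s i c"
      unfolding tt_direction_def
      by (rule direction_matrix_entry; use i s j c(1) tt_env_cong in blast)+
    show ?thesis
      using l unfolding c_def[symmetric]
      by (elim insertE emptyE; hypsubst)
        (simp_all only: entry env_sum env_s P_mat_sandwich(2)[OF Q Q' a b] Q_left Q'_bottom
          mult_minus_left mult_minus_right)
  qed
qed

section \<open>Inner dimensions and assembly of both formats\<close>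

lemma cp_dims:
  "cp_direction d n x R u \<theta> s l \<in> carrier_mat (\<Prod>m<d. n m) (n s * R)"
  "dim_col (cp_Psi d n x R u \<theta> s) = 2 * n s * R"
  "dim_row (cp_C n x P R u \<theta> s) = 2 * n s * R"
  by (simp_all add: cp_Psi_def cp_C_def cp_direction_def cp_sensitivity_def direction_matrix_def
      sensitivity_def)

lemma tt_dims:
  "tt_direction d n x r G \<theta> s l \<in> carrier_mat (\<Prod>m<d. n m) (n s * (r s * r (Suc s)))"
  "dim_col (tt_Psi d n x r G \<theta> s) = 2 * n s * (r s * r (Suc s))"
  "dim_row (tt_C n x P r G \<theta> s) = 2 * n s * (r s * r (Suc s))"
  by (simp_all add: tt_Psi_def tt_C_def tt_direction_def tt_sensitivity_def direction_matrix_def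
      sensitivity_def)

theorem proposition5p2:
  fixes d R :: nat and n P r :: "nat \<Rightarrow> nat"
    and x :: "nat \<Rightarrow> nat \<Rightarrow> real"
    and \<theta> :: "nat \<Rightarrow> real vec"
    and u :: "nat \<Rightarrow> nat \<Rightarrow> real vec \<Rightarrow> real \<Rightarrow> real"
    and G :: "nat \<Rightarrow> real vec \<Rightarrow> real \<Rightarrow> real mat"
  assumes grid: "\<And>m j. m < d \<Longrightarrow> j < n m \<Longrightarrow> x m j \<in> {0<..<1}"
    and param: "\<And>m. m < d \<Longrightarrow> \<theta> m \<in> carrier_vec (P m)"
  shows
    "(cp_ansatz d R P u \<longrightarrow>
        (\<forall>s<d.
           jacobian_block d n x P (cp_eval d R u) \<theta> s
             = cp_Psi d n x R u \<theta> s * cp_C n x P R u \<theta> s \<and>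
           dim_col (cp_Psi d n x R u \<theta> s) = 2 * n s * R \<and>
           dim_row (cp_C n x P R u \<theta> s) = 2 * n s * R \<and>
           (\<forall>l\<in>{0,2}. cp_direction d n x R u \<theta> s l \<in> carrier_mat (\<Prod>m<d. n m) (n s * R)) \<and>
           (\<forall>i. (\<forall>m<d. i m < n m) \<longrightarrow> (\<forall>j<n s. \<forall>\<alpha><R.
              cp_direction d n x R u \<theta> s 0 $$ (mi_pos d n i, pair_pos R j \<alpha>)
                = - of_bool (i s = j) *
                  (\<Sum>\<beta>\<in>{..<d} - {s}. (deriv ^^ 2) (u \<beta> \<alpha> (\<theta> \<beta>)) (x \<beta> (i \<beta>)) *
                     (\<Prod>m\<in>{..<d} - {s, \<beta>}. u m \<alpha> (\<theta> m) (x m (i m)))) \<and>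
              cp_direction d n x R u \<theta> s 2 $$ (mi_pos d n i, pair_pos R j \<alpha>)
                = - of_bool (i s = j) * (\<Prod>m\<in>{..<d} - {s}. u m \<alpha> (\<theta> m) (x m (i m)))))) \<and>
        eff_dim d (cp_Psi d n x R u \<theta>) = 2 * R * (\<Sum>s<d. n s)) \<and>
     (tt_ansatz d r P G \<longrightarrow>
        (\<forall>s<d.
           jacobian_block d n x P (tt_eval d G) \<theta> s
             = tt_Psi d n x r G \<theta> s * tt_C n x P r G \<theta> s \<and>
           dim_col (tt_Psi d n x r G \<theta> s) = 2 * n s * (r s * r (Suc s)) \<and>
           dim_row (tt_C n x P r G \<theta> s) = 2 * n s * (r s * r (Suc s)) \<and>
           (\<forall>l\<in>{0,2}. tt_direction d n x r G \<theta> s l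
              \<in> carrier_mat (\<Prod>m<d. n m) (n s * (r s * r (Suc s)))) \<and>
           (\<forall>i. (\<forall>m<d. i m < n m) \<longrightarrow>
              Q_before r G \<theta> s (\<lambda>m. x m (i m)) \<in> carrier_mat 1 (2 * r s) \<and>
              Q_after d G \<theta> s (\<lambda>m. x m (i m)) \<in> carrier_mat (2 * r (Suc s)) 1 \<and>
              (\<forall>l\<in>{0,2}. \<forall>j<n s. \<forall>a<r s. \<forall>b<r (Suc s).
                 tt_direction d n x r G \<theta> s l
                     $$ (mi_pos d n i, pair_pos (r s * r (Suc s)) j (pair_pos (r (Suc s)) a b))
                   = of_bool (i s = j) *
                     (Q_before r G \<theta> s (\<lambda>m. x m (i m)) * P_mat (r s) (r (Suc s)) l a b *
                      Q_after d G \<theta> s (\<lambda>m. x m (i m))) $$ (0, 0)))) \<and>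
        eff_dim d (tt_Psi d n x r G \<theta>) = 2 * (\<Sum>s<d. n s * r s * r (Suc s)))"
proof (intro conjI impI allI ballI)
  show "jacobian_block d n x P (cp_eval d R u) \<theta> s = cp_Psi d n x R u \<theta> s * cp_C n x P R u \<theta> s"
    if "cp_ansatz d R P u" "s < d" for s
    using cp_factorization[OF that(2) grid param that(1)] .
  show "jacobian_block d n x P (tt_eval d G) \<theta> s = tt_Psi d n x r G \<theta> s * tt_C n x P r G \<theta> s"
    if "tt_ansatz d r P G" "s < d" for s
    using tt_factorization[OF that(2) grid param that(1)] .
  \<comment> \<open>The factor 2 counts the channels 0 and 2, each contributing
    \<open>n s * R\<close> columns.\<close>
  show "eff_dim d (cp_Psi d n x R u \<theta>) = 2 * R * (\<Sum>s<d. n s)"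
    by (simp add: eff_dim_def cp_dims sum_distrib_left mult_ac)
  show "eff_dim d (tt_Psi d n x r G \<theta>) = 2 * (\<Sum>s<d. n s * r s * r (Suc s))"
    by (simp add: eff_dim_def tt_dims sum_distrib_left mult_ac)
  fix i and s j a b l :: nat
  assume "tt_ansatz d r P G" "s < d" "\<forall>m<d. i m < n m"
  note transfer = tt_direction_transfer[where i = i and x = x, OF this(1,2) grid param]
  show "Q_before r G \<theta> s (\<lambda>m. x m (i m)) \<in> carrier_mat 1 (2 * r s)"
    "Q_after d G \<theta> s (\<lambda>m. x m (i m)) \<in> carrier_mat (2 * r (Suc s)) 1"
    using transfer(1,2) \<open>\<forall>m<d. i m < n m\<close> by blast+
  assume "l \<in> {0, 2}" "j < n s" "a < r s" "b < r (Suc s)"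
  then show "tt_direction d n x r G \<theta> s l
        $$ (mi_pos d n i, pair_pos (r s * r (Suc s)) j (pair_pos (r (Suc s)) a b))
      = of_bool (i s = j) *
        (Q_before r G \<theta> s (\<lambda>m. x m (i m)) * P_mat (r s) (r (Suc s)) l a b *
         Q_after d G \<theta> s (\<lambda>m. x m (i m))) $$ (0, 0)"
    using transfer(3) \<open>\<forall>m<d. i m < n m\<close> by blast
qed (simp_all only: cp_dims tt_dims cp_direction_entry)

end
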